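(* There is a universal constant $d>0$ such that for all integers $n>k\ge 1$, $$\sqrt{\binom{n}{k}}\; e^{-d\sqrt{n}} \,\le\, \mathbf{C}(n,k)\,\le\, \sqrt{\binom{n}{k}}.$$
   Context: The Littlewood–Richardson coefficients $c^\lambda_{\mu,\nu}$ are defined by $s_\mu\cdot s_\nu=\sum_\lambda c^\lambda_{\mu,\nu}s_\lambda$, where $s_\lambda$ are Schur functions. Define $\mathbf{C}(n,k):=\max_{\lambda\vdash n}\max_{\mu\vdash k}\max_{\nu\vdash n-k} c^\lambda_{\mu,\nu}$. *)

theory Defs
  imports Complex_Main "HOL-Library.Multiset"
begin

text \<open>Integer partitions, written as weakly decreasing lists of positive parts.\<close>

definition is_partition :: "nat list \<Rightarrow> bool" where
  "is_partition la \<longleftrightarrow> sorted_wrt (\<ge>) la \<and> 0 \<notin> set la"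

definition partitions_of :: "nat \<Rightarrow> nat list set" where
  "partitions_of n = {la. is_partition la \<and> sum_list la = n}"

text \<open>A tableau is the list of its rows; its entries are variable indices, so that the
  tableau contributes the monomial given by the multiset of its entries.\<close>

definition semistandard :: "nat list list \<Rightarrow> bool" where
  "semistandard T \<longleftrightarrow>
     (\<forall>row \<in> set T. sorted row) \<and>
     (\<forall>i j. Suc i < length T \<and> j < length (T ! Suc i) \<longrightarrow> T ! i ! j < T ! Suc i ! j)"

definition SSYT :: "nat list \<Rightarrow> nat list list set" where
  "SSYT la = {T. map length T = la \<and> semistandard T}"

text \<open>Integral formal power series in the variables \<open>x\<^sub>0, x\<^sub>1, x\<^sub>2, \<dots>\<close>, given by their coefficients;
  a monomial is the finite multiset of the indices of its variables.\<close>

type_synonym mseries = "nat multiset \<Rightarrow> int"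

definition mseries_mult :: "mseries \<Rightarrow> mseries \<Rightarrow> mseries" where
  "mseries_mult f g = (\<lambda>a. \<Sum>(b, c) \<in> {(b, c). b + c = a}. f b * g c)"

definition schur :: "nat list \<Rightarrow> mseries" where
  "schur la = (\<lambda>a. int (card {T \<in> SSYT la. mset (concat T) = a}))"

text \<open>The Littlewood--Richardson coefficients, indexed by \<open>\<lambda>\<close>, are the coordinates of
  \<open>s\<^sub>\<mu> \<cdot> s\<^sub>\<nu>\<close> in the basis of Schur functions, i.e. the unique finitely supported
  family of integers with \<open>s\<^sub>\<mu> \<cdot> s\<^sub>\<nu> = (\<Sum>\<lambda>. c\<^sub>\<lambda> s\<^sub>\<lambda>)\<close>.\<close>

definition is_schur_expansion :: "mseries \<Rightarrow> (nat list \<Rightarrow> int) \<Rightarrow> bool" where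
  "is_schur_expansion f c \<longleftrightarrow>
     finite {la. c la \<noteq> 0} \<and>
     {la. c la \<noteq> 0} \<subseteq> Collect is_partition \<and>
     f = (\<lambda>a. \<Sum>la | c la \<noteq> 0. c la * schur la a)"

definition LR_coeff :: "nat list \<Rightarrow> nat list \<Rightarrow> nat list \<Rightarrow> int" where
  "LR_coeff la mu nu =
     (THE c. is_schur_expansion (mseries_mult (schur mu) (schur nu)) c) la"

definition LR_max :: "nat \<Rightarrow> nat \<Rightarrow> int" where
  "LR_max n k =
     (MAX la \<in> partitions_of n. MAX mu \<in> partitions_of k. MAX nu \<in> partitions_of (n - k).
        LR_coeff la mu nu)"

text \<open>The sets under \<open>card\<close>, \<open>sum\<close> and \<open>Max\<close> above are finite, and those under \<open>Max\<close> nonempty.\<close>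

lemma finite_SSYT_content: "finite {T \<in> SSYT la. mset (concat T) = a}"
proof -
  let ?R = "{row. set row \<subseteq> set_mset a \<and> length row \<le> size a}"
  have "row \<in> ?R" if T: "mset (concat T) = a" and row: "row \<in> set T" for T row
  proof -
    from row have "mset row \<subseteq># mset (concat T)"
      by (induction T) (auto intro: subset_mset.add_increasing subset_mset.add_increasing2)
    with T have "mset row \<subseteq># a" by simp
    then show ?thesis
      using set_mset_mono size_mset_mono by fastforce
  qed
  then have "{T \<in> SSYT la. mset (concat T) = a} \<subseteq> {T. set T \<subseteq> ?R \<and> length T = length la}"
    by (auto simp: SSYT_def)
  moreover have "finite ?R" by (rule finite_lists_length_le) simp
  ultimately show ?thesis
    using finite_lists_length_eq finite_subset by blast
qed

lemma finite_mset_splittings: "finite {(b, c). b + c = (a :: 'a multiset)}"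
proof (rule finite_subset)
  let ?S = "mset ` {xs. set xs \<subseteq> set_mset a \<and> length xs \<le> size a}"
  show "{(b, c). b + c = a} \<subseteq> ?S \<times> ?S"
  proof clarify
    fix b c assume a: "a = b + c"
    obtain xs ys where "b = mset xs" "c = mset ys" by (metis ex_mset)
    with a show "b \<in> mset ` {xs. set xs \<subseteq> set_mset (b + c) \<and> length xs \<le> size (b + c)} \<and>
                 c \<in> mset ` {xs. set xs \<subseteq> set_mset (b + c) \<and> length xs \<le> size (b + c)}"
      by auto
  qed
  show "finite (?S \<times> ?S)"
    by (intro finite_cartesian_product finite_imageI finite_lists_length_le) simp_all
qed

lemma finite_partitions_of: "finite (partitions_of n)"
proof (rule finite_subset)
  have "length la \<le> sum_list la" if "0 \<notin> set la" for la :: "nat list"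
    using that by (induction la) auto
  then show "partitions_of n \<subseteq> {la. set la \<subseteq> {..n} \<and> length la \<le> n}"
    by (auto simp: partitions_of_def is_partition_def member_le_sum_list)
  show "finite {la. set la \<subseteq> {..n} \<and> length la \<le> n}"
    by (rule finite_lists_length_le) simp
qed

lemma partitions_of_nonempty: "partitions_of n \<noteq> {}"
proof -
  have "(if n = 0 then [] else [n]) \<in> partitions_of n"
    by (simp add: partitions_of_def is_partition_def)
  then show ?thesis by blast
qed

end

theory Submission
  imports Defs "HOL-Combinatorics.Combinatorics"
begin

text \<open>
  Let \<open>f\<^sup>\<lambda>\<close> be the number of standard tableaux of shape \<open>\<lambda>\<close> and \<open>p(n)\<close> the number of partitions of
  \<open>n\<close>. For \<open>n = k + l\<close> everything follows from three identities,
  \<open>\<Sum>\<^sub>\<lambda> (f\<^sup>\<lambda>)\<^sup>2 = n!\<close>, \<open>\<Sum>\<^sub>\<lambda> c\<^sup>\<lambda> f\<^sup>\<lambda> = (n choose k) f\<^sup>\<mu> f\<^sup>\<nu>\<close> for fixed \<open>\<mu>, \<nu>\<close>, and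
  \<open>\<Sum>\<^sub>\<mu>\<^sub>\<nu> c\<^sup>\<lambda> f\<^sup>\<mu> f\<^sup>\<nu> = f\<^sup>\<lambda>\<close> for fixed \<open>\<lambda>\<close>, where \<open>c\<^sup>\<lambda>\<close> is the Littlewood-Richardson coefficient of
  \<open>\<lambda>, \<mu>, \<nu>\<close> (\<open>sum_num_standard_squares\<close>, \<open>num_standard_induction\<close>, \<open>num_standard_restriction\<close>).

  Upper bound: as \<open>c \<ge> 0\<close>, a single term is at most the sum, so \<open>c f\<^sup>\<lambda> \<le> (n choose k) f\<^sup>\<mu> f\<^sup>\<nu>\<close> and
  \<open>c f\<^sup>\<mu> f\<^sup>\<nu> \<le> f\<^sup>\<lambda>\<close>; the product of the two is \<open>c\<^sup>2 \<le> n choose k\<close>. Lower bound: some \<open>\<lambda>\<close> has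
  \<open>f\<^sup>\<lambda> \<ge> \<surd>(n!/p(n))\<close>, while \<open>f\<^sup>\<mu> \<le> \<surd>k!\<close> and \<open>f\<^sup>\<nu> \<le> \<surd>l!\<close>, so the third identity forces a coefficient
  of at least \<open>\<surd>(n choose k) / (p(k) p(l) \<surd>p(n))\<close>, and \<open>p(m) \<le> e\<^bsup>14\<surd>m\<^esup>\<close>
  (\<open>card_partitions_le_exp_sqrt\<close>).

  The theory of Schur functions behind this rests on the functional \<open>alt_coef\<close>, the coefficient of
  \<open>x\<^bsup>\<alpha> + \<rho>\<^esup>\<close> in \<open>a\<^sub>\<rho> f\<close> for the Vandermonde alternant \<open>a\<^sub>\<rho>\<close>. Stembridge's sign-reversing involution
  (\<open>alternating_cancellation\<close>) evaluates it on products \<open>f s\<^sub>\<nu>\<close> as a sum over tableaux with a lattice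
  condition. This one result has all the needed consequences: the functionals are dual to the Schur
  functions (\<open>alt_coef_schur\<close>), hence every homogeneous symmetric series has a unique Schur expansion
  (\<open>schur_expansion\<close>, \<open>schur_independent\<close>), and Littlewood-Richardson coefficients are nonnegative
  (\<open>LR_coeff_nonneg\<close>). The involution is a partial Bender-Knuth involution; with tableaux encoded as
  Gelfand-Tsetlin patterns it just reflects each entry of one level in the interval allowed by its
  neighbours.

  The identities come from coefficients of squarefree monomials and from the expansion
  \<open>h\<^sub>1\<^sup>n = \<Sum>\<^sub>\<lambda> f\<^sup>\<lambda> s\<^sub>\<lambda>\<close>, which holds because both \<open>f\<^sup>\<lambda>\<close> and \<open>alt_coef\<close> of \<open>h\<^sub>1\<^sup>n\<close> satisfy the recursion
  over the corners of \<open>\<lambda>\<close>. The third identity, in particular, is \<open>h\<^sub>1\<^sup>n = h\<^sub>1\<^sup>k h\<^sub>1\<^sup>l\<close> read in the Schur basis.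
\<close>

section \<open>Coefficients at integer exponent vectors\<close>

text \<open>Exponent vectors are shifted by permutations and by weights below, so they may become
  negative or acquire infinite support; such vectors get coefficient zero.\<close>
definition coef :: "mseries \<Rightarrow> (nat \<Rightarrow> int) \<Rightarrow> int" where
  "coef f \<alpha> = (if (\<forall>i. 0 \<le> \<alpha> i) \<and> finite {i. \<alpha> i \<noteq> 0}
               then f (Abs_multiset (\<lambda>i. nat (\<alpha> i))) else 0)"

lemma coef_count: "coef f (\<lambda>i. int (count a i)) = f a"
proof -
  have "finite {i. int (count a i) \<noteq> 0}" by simp
  then show ?thesis by (simp add: coef_def count_inverse)
qed

text \<open>The junk vectors are junk for every series at once, which lets identities between coefficients
  be proved by comparing multisets.\<close>
lemma exponent_cases:
  obtains a where "\<alpha> = (\<lambda>i. int (count a i))" | "\<And>f. coef f \<alpha> = 0"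
proof (cases "(\<forall>i. 0 \<le> \<alpha> i) \<and> finite {i. \<alpha> i \<noteq> 0}")
  case True
  then have "{i. nat (\<alpha> i) > 0} \<subseteq> {i. \<alpha> i \<noteq> 0}" by auto
  with True have "finite {i. nat (\<alpha> i) > 0}" by (blast intro: finite_subset)
  then have "\<alpha> = (\<lambda>i. int (count (Abs_multiset (\<lambda>i. nat (\<alpha> i))) i))"
    using True by (simp add: fun_eq_iff count_Abs_multiset)
  then show ?thesis using that(1) by blast
next
  case False
  then have "coef f \<alpha> = 0" for f by (simp only: coef_def if_False)
  then show ?thesis using that(2) by blast
qed

lemma coef_negative: "\<alpha> i < 0 \<Longrightarrow> coef f \<alpha> = 0"
  by (metis coef_def not_le)

lemma coef_diff_count:
  "coef f (\<lambda>i. int (count a i) - int (count c i)) = (if c \<subseteq># a then f (a - c) else 0)"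
proof (cases "c \<subseteq># a")
  case True
  then have "(\<lambda>i. int (count a i) - int (count c i)) = (\<lambda>i. int (count (a - c) i))"
    by (simp add: fun_eq_iff of_nat_diff mset_subset_eq_count)
  with True show ?thesis by (simp only: coef_count if_True)
next
  case False
  then obtain i where "count a i < count c i" by (meson mset_subset_eqI not_le)
  then show ?thesis using False by (simp add: coef_negative[of _ i])
qed

lemma coef_sum: "coef (\<lambda>a. \<Sum>x\<in>A. c x * F x a) \<alpha> = (\<Sum>x\<in>A. c x * coef (F x) \<alpha>)"
  by (cases \<alpha> rule: exponent_cases) (simp_all add: coef_count)

lemma coef_minus: "coef (\<lambda>a. f a - g a) \<alpha> = coef f \<alpha> - coef g \<alpha>"
  by (simp add: coef_def)

text \<open>Adjacent transpositions generate all finite permutations of the variables.\<close>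
definition symmetric :: "mseries \<Rightarrow> bool" where
  "symmetric f \<longleftrightarrow> (\<forall>k a. f (image_mset (transpose k (Suc k)) a) = f a)"

lemma count_image_transpose:
  "count (image_mset (transpose k (Suc k)) a) i = count a (transpose k (Suc k) i)"
proof (induction a)
  case (add x a)
  have "transpose k (Suc k) x = i \<longleftrightarrow> x = transpose k (Suc k) i"
    by (metis transpose_involutory)
  with add show ?case by simp
qed simp

lemma symmetric_coef:
  assumes "symmetric f"
  shows "coef f (\<alpha> \<circ> transpose k (Suc k)) = coef f \<alpha>"
proof (cases \<alpha> rule: exponent_cases)
  case (1 a)
  then have "\<alpha> \<circ> transpose k (Suc k) = (\<lambda>i. int (count (image_mset (transpose k (Suc k)) a) i))"
    by (simp add: fun_eq_iff count_image_transpose)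
  with 1 assms show ?thesis by (simp add: coef_count symmetric_def)
next
  case 2
  show ?thesis
  proof (cases "\<alpha> \<circ> transpose k (Suc k)" rule: exponent_cases)
    case (1 a)
    then have "\<alpha> = (\<lambda>i. int (count (image_mset (transpose k (Suc k)) a) i))"
      by (auto simp add: fun_eq_iff count_image_transpose) (metis transpose_involutory)
    with 1 assms show ?thesis by (simp add: coef_count symmetric_def)
  next
    case zero: 2
    show ?thesis using 2 zero by simp
  qed
qed

section \<open>Alternating sums\<close>

text \<open>With the staircase \<open>\<rho> = (0, -1, -2, \<dots>)\<close> this is
  \<open>\<Sum>\<^sub>w sgn(w) [x\<^bsup>\<alpha> + \<rho> - w\<rho>\<^esup>] f\<close>, the coefficient of \<open>x\<^bsup>\<alpha> + \<rho>\<^esup>\<close> in the product of \<open>f\<close> with the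
  Vandermonde alternant \<open>a\<^sub>\<rho>\<close> in the first \<open>N\<close> variables. In the bialternant description
  \<open>a\<^sub>\<rho> s\<^sub>\<mu> = a\<^bsub>\<mu> + \<rho>\<^esub>\<close> this functional, at a dominant \<open>\<alpha>\<close>, reads off the coordinate of \<open>f\<close> at
  \<open>s\<^sub>\<alpha>\<close>. Working with the functional avoids dividing by \<open>a\<^sub>\<rho>\<close>.\<close>
definition alt_coef :: "nat \<Rightarrow> mseries \<Rightarrow> (nat \<Rightarrow> int) \<Rightarrow> int" where
  "alt_coef N f \<alpha> = (\<Sum>w | w permutes {..<N}. sign w * coef f (\<lambda>i. \<alpha> i - int i + int (w i)))"

lemma alt_coef_sum:
  "alt_coef N (\<lambda>a. \<Sum>x\<in>A. c x * F x a) \<alpha> = (\<Sum>x\<in>A. c x * alt_coef N (F x) \<alpha>)"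
  unfolding alt_coef_def coef_sum sum_distrib_left
  by (subst sum.swap) (simp add: mult_ac)

lemma alt_coef_minus:
  "alt_coef N (\<lambda>a. f a - g a) \<alpha> = alt_coef N f \<alpha> - alt_coef N g \<alpha>"
  unfolding alt_coef_def coef_minus by (simp add: right_diff_distrib sum_subtractf)

text \<open>The argument on the left is \<open>s\<^sub>k(\<alpha> + \<rho>) - \<rho>\<close>, the dot action of the transposition \<open>s\<^sub>k\<close>. As \<open>f\<close> is
  symmetric, the transposition can be moved to the summation variable \<open>w\<close>, where it costs a sign.\<close>
lemma alt_coef_antisymmetric:
  assumes sym: "symmetric f" and k: "Suc k < N"
  shows "alt_coef N f (\<lambda>i. \<alpha> (transpose k (Suc k) i) - int (transpose k (Suc k) i) + int i)
       = - alt_coef N f \<alpha>"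
proof -
  let ?t = "transpose k (Suc k)"
  have t: "?t permutes {..<N}" using k by (intro permutes_swap_id) auto
  have "alt_coef N f (\<lambda>i. \<alpha> (?t i) - int (?t i) + int i)
      = (\<Sum>w | w permutes {..<N}. sign w * coef f (\<lambda>i. \<alpha> (?t i) - int (?t i) + int (w i)))"
    by (simp add: alt_coef_def)
  also have "\<dots> = (\<Sum>w | w permutes {..<N}. sign w * coef f (\<lambda>i. \<alpha> i - int i + int ((w \<circ> ?t) i)))"
  proof (intro sum.cong refl)
    fix w
    have "(\<lambda>i. \<alpha> (?t i) - int (?t i) + int (w i)) =
        (\<lambda>i. \<alpha> i - int i + int ((w \<circ> ?t) i)) \<circ> ?t" by (simp add: fun_eq_iff)
    then show "sign w * coef f (\<lambda>i. \<alpha> (?t i) - int (?t i) + int (w i)) =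
        sign w * coef f (\<lambda>i. \<alpha> i - int i + int ((w \<circ> ?t) i))"
      by (simp only: symmetric_coef[OF sym])
  qed
  also have "\<dots> = (\<Sum>w | w permutes {..<N}. - (sign w * coef f (\<lambda>i. \<alpha> i - int i + int (w i))))"
  proof (rule sum.reindex_bij_witness[where i = "\<lambda>w. w \<circ> ?t" and j = "\<lambda>w. w \<circ> ?t"])
    fix w assume w: "w \<in> {w. w permutes {..<N}}"
    then have p: "permutation w" by (metis finite_lessThan mem_Collect_eq permutation_permutes)
    have "sign (w \<circ> ?t) = - sign w"
      using sign_compose[OF p permutation_swap_id[of k "Suc k"]] by (simp add: sign_swap_id)
    then show "- (sign (w \<circ> ?t) * coef f (\<lambda>i. \<alpha> i - int i + int ((w \<circ> ?t) i))) =
        sign w * coef f (\<lambda>i. \<alpha> i - int i + int ((w \<circ> ?t) i))" by simp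
    show "w \<circ> ?t \<in> {w. w permutes {..<N}}" using w t by (simp add: permutes_compose)
  qed (simp_all add: t permutes_compose comp_assoc)
  also have "\<dots> = - alt_coef N f \<alpha>" by (simp add: alt_coef_def sum_negf)
  finally show ?thesis .
qed

text \<open>Such an \<open>\<alpha>\<close> is fixed by the dot action, so the value is its own negative.\<close>
lemma alt_coef_wall:
  assumes "symmetric f" "Suc k < N" "\<alpha> (Suc k) = \<alpha> k + 1"
  shows "alt_coef N f \<alpha> = 0"
proof -
  have "(\<lambda>i. \<alpha> (transpose k (Suc k) i) - int (transpose k (Suc k) i) + int i) = \<alpha>"
    using assms(3) by (auto simp: fun_eq_iff transpose_def)
  with alt_coef_antisymmetric[OF assms(1,2), of \<alpha>] show ?thesis by simp
qed

definition decreasing :: "nat \<Rightarrow> (nat \<Rightarrow> int) \<Rightarrow> bool" where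
  "decreasing N \<alpha> \<longleftrightarrow> (\<forall>i. Suc i < N \<longrightarrow> \<alpha> (Suc i) \<le> \<alpha> i)"

lemma decreasingD:
  assumes "decreasing N \<alpha>" "i \<le> j" "j < N"
  shows "\<alpha> j \<le> \<alpha> i"
  using assms(2,3)
proof (induction j rule: dec_induct)
  case (step j)
  then show ?case using assms(1) unfolding decreasing_def by (meson Suc_lessD order_trans)
qed simp

definition one :: mseries where "one a = (if a = {#} then 1 else 0)"

lemma coef_one: "coef one \<alpha> = (if \<alpha> = (\<lambda>i. 0) then 1 else 0)"
proof (cases \<alpha> rule: exponent_cases)
  case (1 a)
  then have "\<alpha> = (\<lambda>i. 0) \<longleftrightarrow> a = {#}" by (auto simp: fun_eq_iff multiset_eq_iff)
  then show ?thesis by (simp add: 1 coef_count one_def)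
next
  case 2
  moreover have "coef one (\<lambda>i. 0) = 1" using coef_count[of one "{#}"] by (simp add: one_def)
  ultimately show ?thesis by auto
qed

lemma symmetric_one: "symmetric one"
  by (simp add: symmetric_def one_def)

text \<open>A permutation can raise the last entry of \<open>\<alpha> + \<rho>\<close> by at most \<open>N - 1\<close>, which is what the staircase
  subtracted, so every exponent vector in the sum keeps a negative entry.\<close>
lemma alt_coef_last_negative:
  assumes "0 < N" "\<alpha> (N - 1) < 0"
  shows "alt_coef N f \<alpha> = 0"
  unfolding alt_coef_def
proof (intro sum.neutral ballI)
  fix w assume "w \<in> {w. w permutes {..<N}}"
  then have "w (N - 1) < N" using assms(1) permutes_in_image[of w "{..<N}" "N - 1"] by simp
  then have "\<alpha> (N - 1) - int (N - 1) + int (w (N - 1)) < 0" using assms by linarith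
  then have "coef f (\<lambda>i. \<alpha> i - int i + int (w i)) = 0" by (rule coef_negative)
  then show "sign w * coef f (\<lambda>i. \<alpha> i - int i + int (w i)) = 0" by simp
qed

text \<open>A nonzero summand has \<open>w(i) = i - \<alpha>(i)\<close>; as \<open>\<alpha>\<close> decreases, \<open>w\<close> is strictly increasing, hence the
  identity.\<close>
lemma alt_coef_one:
  assumes dec: "decreasing N \<alpha>" and supp: "\<And>i. i \<ge> N \<Longrightarrow> \<alpha> i = 0"
  shows "alt_coef N one \<alpha> = (if \<alpha> = (\<lambda>i. 0) then 1 else 0)"
proof -
  have *: "w = id" if w: "w permutes {..<N}" and 0: "\<And>i. \<alpha> i - int i + int (w i) = 0" for w
  proof -
    have ge: "i \<le> w i" if "i < N" for i using that
    proof (induction i)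
      case (Suc i)
      have "\<alpha> (Suc i) \<le> \<alpha> i" using dec Suc.prems by (simp add: decreasing_def)
      moreover have "i \<le> w i" using Suc by simp
      ultimately show ?case using 0[of i] 0[of "Suc i"] by linarith
    qed simp
    have "(\<Sum>i<N. w i) = (\<Sum>i<N. i)" using sum.permute[OF w, of id] by (simp add: comp_def)
    then have "(\<Sum>i<N. w i - i) = 0"
      using ge by (subst sum_subtractf_nat) auto
    then have "w i = i" if "i < N" for i using ge[OF that] that by (auto dest!: bspec)
    then show ?thesis using w by (auto simp: fun_eq_iff permutes_def)
  qed
  have "alt_coef N one \<alpha> = (\<Sum>w | w permutes {..<N}. if w = id \<and> \<alpha> = (\<lambda>i. 0) then 1 else 0)"
    unfolding alt_coef_def
  proof (intro sum.cong refl)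
    fix w assume "w \<in> {w. w permutes {..<N}}"
    then have "w = id" if "(\<lambda>i. \<alpha> i - int i + int (w i)) = (\<lambda>i. 0)"
      using that * by (metis mem_Collect_eq)
    then have "(\<lambda>i. \<alpha> i - int i + int (w i)) = (\<lambda>i. 0) \<longleftrightarrow> w = id \<and> \<alpha> = (\<lambda>i. 0)"
      by auto
    then show "sign w * coef one (\<lambda>i. \<alpha> i - int i + int (w i)) =
        (if w = id \<and> \<alpha> = (\<lambda>i. 0) then 1 else 0)"
      by (auto simp: coef_one sign_id)
  qed
  also have "\<dots> = (if \<alpha> = (\<lambda>i. 0) then 1 else 0)"
    by (cases "\<alpha> = (\<lambda>i. 0)") (simp_all add: finite_permutations permutes_id)
  finally show ?thesis .
qed

section \<open>Gelfand-Tsetlin patterns\<close>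

text \<open>A semistandard tableau with entries below \<open>N\<close> is encoded by the chain of shapes of its subtableaux:
  \<open>H m r\<close> is the number of entries smaller than \<open>m\<close> in row \<open>r\<close>. Column strictness turns into the
  interlacing inequalities (consecutive shapes differ by a horizontal strip). The sequence is continued
  constantly beyond level \<open>N\<close>, which makes the weight formulas independent of \<open>N\<close>.\<close>
definition gt_patterns :: "nat \<Rightarrow> (nat \<Rightarrow> nat) \<Rightarrow> (nat \<Rightarrow> nat \<Rightarrow> nat) set" where
  "gt_patterns N nu = {H. (\<forall>r. H 0 r = 0) \<and>
     (\<forall>m r. H (Suc m) (Suc r) \<le> H m r \<and> H m r \<le> H (Suc m) r) \<and>
     (\<forall>m\<ge>N. H m = nu)}"

text \<open>The number of entries equal to \<open>m\<close>. Only the rows \<open>r \<le> m\<close> can contain the letter \<open>m\<close>, so the sum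
  may be cut there; \<open>weight_rows\<close> shows that any larger cut gives the same value.\<close>
definition weight :: "(nat \<Rightarrow> nat \<Rightarrow> nat) \<Rightarrow> nat \<Rightarrow> int" where
  "weight H m = (\<Sum>r\<le>m. int (H (Suc m) r) - int (H m r))"

text \<open>The pattern of the subtableau formed by the first \<open>j\<close> columns.\<close>
definition clip :: "nat \<Rightarrow> (nat \<Rightarrow> nat \<Rightarrow> nat) \<Rightarrow> nat \<Rightarrow> nat \<Rightarrow> nat" where
  "clip j H m r = min j (H m r)"

lemma gtD:
  assumes "H \<in> gt_patterns N nu"
  shows "H 0 r = 0" "H (Suc m) (Suc r) \<le> H m r" "H m r \<le> H (Suc m) r" "m \<ge> N \<Longrightarrow> H m = nu"
  using assms by (auto simp: gt_patterns_def)

lemma gt_zero: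
  assumes "H \<in> gt_patterns N nu" "m \<le> r"
  shows "H m r = 0"
  using assms(2)
proof (induction m arbitrary: r)
  case (Suc m)
  then obtain r' where r: "r = Suc r'" "m \<le> r'" by (cases r) auto
  then have "H (Suc m) r \<le> H m r'" using gtD(2)[OF assms(1)] by simp
  also have "\<dots> = 0" using Suc.IH r by simp
  finally show ?case by simp
qed (simp add: gtD[OF assms(1)])

lemma gt_mono:
  assumes "H \<in> gt_patterns N nu" "m \<le> m'"
  shows "H m r \<le> H m' r"
  using assms(2) by (induction m' rule: dec_induct) (auto intro: order_trans gtD(3)[OF assms(1)])

lemma gt_le:
  assumes "H \<in> gt_patterns N nu"
  shows "H m r \<le> nu r"
  using gt_mono[OF assms, of m "max m N" r] gtD(4)[OF assms, of "max m N"] by simp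

lemma finite_gt: "finite (gt_patterns N nu)"
proof (rule finite_subset)
  let ?F = "{..<N} \<times> {..<N}"
  \<comment> \<open>Outside the square \<open>?F\<close> the entries are forced to be zero or a part of \<open>nu\<close>.\<close>
  let ?ext = "\<lambda>h m r. if N \<le> m then nu r else if (m, r) \<in> ?F then h (m, r) else 0"
  let ?S = "\<Pi>\<^sub>E (m, r) \<in> ?F. {..nu r}"
  show "finite (?ext ` ?S)"
    by (intro finite_imageI finite_PiE) auto
  show "gt_patterns N nu \<subseteq> ?ext ` ?S"
  proof
    fix H assume H: "H \<in> gt_patterns N nu"
    let ?h = "restrict (\<lambda>(m, r). H m r) ?F"
    have "?h \<in> ?S" using gt_le[OF H] by (auto simp: PiE_def extensional_def)
    moreover have "H m r = ?ext ?h m r" for m r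
      using gtD(4)[OF H] gt_zero[OF H, of m r] by auto
    then have "H = ?ext ?h" by blast
    ultimately show "H \<in> ?ext ` ?S" by blast
  qed
qed

lemma clip_gt: "H \<in> gt_patterns N nu \<Longrightarrow> clip j H \<in> gt_patterns N (\<lambda>r. min j (nu r))"
  by (auto simp: gt_patterns_def clip_def fun_eq_iff min.coboundedI2)

lemma weight_nonneg: "H \<in> gt_patterns N nu \<Longrightarrow> 0 \<le> weight H m"
  unfolding weight_def by (intro sum_nonneg) (simp add: gtD)

lemma weight_beyond: "H \<in> gt_patterns N nu \<Longrightarrow> N \<le> m \<Longrightarrow> weight H m = 0"
  unfolding weight_def by (intro sum.neutral) (simp add: gtD(4))

lemma weight_rows:
  assumes "H \<in> gt_patterns N nu" "m < R"
  shows "weight H m = (\<Sum>r<R. int (H (Suc m) r) - int (H m r))"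
  unfolding weight_def using assms(2)
  by (intro sum.mono_neutral_left) (auto simp: gt_zero[OF assms(1)])

lemma clip_large: "H \<in> gt_patterns N nu \<Longrightarrow> (\<And>r. nu r \<le> j) \<Longrightarrow> clip j H = H"
  unfolding clip_def fun_eq_iff using gt_le by (metis min.absorb2 order_trans)

lemma clip_0: "weight (clip 0 H) m = 0"
  by (simp add: weight_def clip_def)

lemma min_Suc_diff: "int (min (Suc j) x) - int (min j x) = (if j < x then 1 else 0)"
  by auto

lemma weight_clip_Suc:
  assumes "H \<in> gt_patterns N nu" "m < R"
  shows "weight (clip (Suc j) H) m - weight (clip j H) m =
    (\<Sum>r<R. (if j < H (Suc m) r then 1 else 0) - (if j < H m r then 1 else 0))"
proof -
  have "weight (clip (Suc j) H) m - weight (clip j H) m =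
    (\<Sum>r<R. (int (min (Suc j) (H (Suc m) r)) - int (min j (H (Suc m) r))) -
            (int (min (Suc j) (H m r)) - int (min j (H m r))))"
    unfolding weight_rows[OF clip_gt[OF assms(1)] assms(2)] sum_subtractf[symmetric]
    by (simp add: clip_def algebra_simps)
  then show ?thesis by (simp only: min_Suc_diff)
qed

text \<open>The next three facts concern the multiplicity of the letter \<open>m\<close> in column \<open>j\<close>, which is the
  increment of the clipped weight.\<close>
lemma column_letter_nonneg:
  assumes "H \<in> gt_patterns N nu"
  shows "0 \<le> weight (clip (Suc j) H) m - weight (clip j H) m"
  unfolding weight_clip_Suc[OF assms lessI] using gtD(3)[OF assms]
  by (intro sum_nonneg) (auto intro: order.strict_trans2)

text \<open>Interlacing shifts the rows by one: the number of rows of level \<open>m + 1\<close> that reach beyond column \<open>j\<close>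
  exceeds that of level \<open>m\<close> by at most one.\<close>
lemma column_letter_le_1:
  assumes "H \<in> gt_patterns N nu"
  shows "weight (clip (Suc j) H) m - weight (clip j H) m \<le> 1"
proof -
  let ?i = "\<lambda>m r. if j < H m r then 1 else (0::int)"
  have "(\<Sum>r<Suc m. ?i (Suc m) r) = ?i (Suc m) 0 + (\<Sum>r<m. ?i (Suc m) (Suc r))"
    by (rule sum.lessThan_Suc_shift)
  also have "\<dots> \<le> 1 + (\<Sum>r<m. ?i m r)"
    using gtD(2)[OF assms] by (intro add_mono sum_mono) (auto intro: order.strict_trans2)
  also have "\<dots> \<le> 1 + (\<Sum>r<Suc m. ?i m r)" by simp
  finally show ?thesis
    unfolding weight_clip_Suc[OF assms lessI] sum_subtractf by linarith
qed

lemma column_letter_absent: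
  assumes "H \<in> gt_patterns N nu" "weight (clip (Suc j) H) m - weight (clip j H) m \<le> 0" "H m r \<le> j"
  shows "H (Suc m) r \<le> j"
proof (rule ccontr)
  assume *: "\<not> H (Suc m) r \<le> j"
  define R where "R = Suc (max m r)"
  let ?f = "\<lambda>r. (if j < H (Suc m) r then 1 else 0) - (if j < H m r then 1 else (0::int))"
  have "?f r \<le> sum ?f {..<R}"
    using gtD(3)[OF assms(1)]
    by (intro member_le_sum) (auto simp: R_def intro: order.strict_trans2)
  moreover have "?f r = 1" using * assms(3) by simp
  moreover have "m < R" by (simp add: R_def)
  ultimately show False using assms(2) weight_clip_Suc[OF assms(1), of m R j] by linarith
qed

section \<open>The Bender-Knuth toggle\<close>

text \<open>For fixed neighbouring levels \<open>k\<close> and \<open>k + 2\<close>, the interlacing inequalities confine each entry of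
  level \<open>k + 1\<close> to an interval, independently of the other rows; these are its end points, the lower
  one cut off at column \<open>j\<close>.\<close>
definition bk_lower :: "nat \<Rightarrow> nat \<Rightarrow> (nat \<Rightarrow> nat \<Rightarrow> nat) \<Rightarrow> nat \<Rightarrow> nat" where
  "bk_lower j k H r = max j (max (H (Suc (Suc k)) (Suc r)) (H k r))"

definition bk_upper :: "nat \<Rightarrow> (nat \<Rightarrow> nat \<Rightarrow> nat) \<Rightarrow> nat \<Rightarrow> nat" where
  "bk_upper k H r = (case r of 0 \<Rightarrow> H (Suc (Suc k)) 0 | Suc r' \<Rightarrow> min (H (Suc (Suc k)) r) (H k r'))"

text \<open>The Bender-Knuth involution exchanging the numbers of letters \<open>k\<close> and \<open>k + 1\<close>, applied only to the
  columns from \<open>j\<close> on: each entry of level \<open>k + 1\<close> is reflected in its interval. Rows whose level-\<open>k + 1\<close>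
  part ends before column \<open>j\<close> are left alone.\<close>
definition toggle :: "nat \<Rightarrow> nat \<Rightarrow> (nat \<Rightarrow> nat \<Rightarrow> nat) \<Rightarrow> nat \<Rightarrow> nat \<Rightarrow> nat" where
  "toggle j k H = H(Suc k := \<lambda>r. if H (Suc k) r < j then H (Suc k) r
                               else bk_lower j k H r + bk_upper k H r - H (Suc k) r)"

lemma toggle_other: "m \<noteq> Suc k \<Longrightarrow> toggle j k H m = H m"
  by (simp add: toggle_def)

lemma bk_lower_le: "H \<in> gt_patterns N nu \<Longrightarrow> j \<le> H (Suc k) r \<Longrightarrow> bk_lower j k H r \<le> H (Suc k) r"
  by (simp add: bk_lower_def gtD)

lemma le_bk_upper: "H \<in> gt_patterns N nu \<Longrightarrow> H (Suc k) r \<le> bk_upper k H r"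
  by (simp add: bk_upper_def gtD split: nat.split)

lemma toggle_bounds:
  assumes "H \<in> gt_patterns N nu" "j \<le> H (Suc k) r"
  shows "bk_lower j k H r \<le> toggle j k H (Suc k) r" "toggle j k H (Suc k) r \<le> bk_upper k H r"
    "toggle j k H (Suc k) r + H (Suc k) r = bk_lower j k H r + bk_upper k H r"
  using bk_lower_le[OF assms] le_bk_upper[OF assms(1), of k r] assms(2) by (auto simp: toggle_def)

lemma toggle_left: "H (Suc k) r < j \<Longrightarrow> toggle j k H (Suc k) r = H (Suc k) r"
  by (simp add: toggle_def)

lemma toggle_in_gt:
  assumes H: "H \<in> gt_patterns N nu" and k: "Suc k < N"
  shows "toggle j k H \<in> gt_patterns N nu"
proof -
  let ?T = "toggle j k H"
  have lo: "H (Suc (Suc k)) (Suc r) \<le> ?T (Suc k) r" "H k r \<le> ?T (Suc k) r"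
    and hi: "?T (Suc k) r \<le> H (Suc (Suc k)) r" for r
  proof -
    show "H (Suc (Suc k)) (Suc r) \<le> ?T (Suc k) r" "H k r \<le> ?T (Suc k) r"
      using toggle_bounds(1)[OF H, of j k r] toggle_left[of H k r j] gtD(2,3)[OF H]
      by (cases "j \<le> H (Suc k) r"; simp add: bk_lower_def)+
    show "?T (Suc k) r \<le> H (Suc (Suc k)) r"
      using toggle_bounds(2)[OF H, of j k r] toggle_left[of H k r j] gtD(3)[OF H]
      by (cases "j \<le> H (Suc k) r"; simp add: bk_upper_def split: nat.splits)
  qed
  have hi': "?T (Suc k) (Suc r) \<le> H k r" for r
    using toggle_bounds(2)[OF H, of j k "Suc r"] toggle_left[of H k "Suc r" j] gtD(2)[OF H]
    by (cases "j \<le> H (Suc k) (Suc r)"; simp add: bk_upper_def)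
  have "?T (Suc m) (Suc r) \<le> ?T m r \<and> ?T m r \<le> ?T (Suc m) r" for m r
  proof (cases "m = k \<or> m = Suc k")
    case True
    then show ?thesis using lo hi hi' by (auto simp: toggle_other)
  next
    case False
    then show ?thesis using gtD(2,3)[OF H] by (simp add: toggle_other)
  qed
  moreover have "?T m = nu" if "N \<le> m" for m
    using that k gtD(4)[OF H] by (simp add: toggle_other)
  ultimately show ?thesis using gtD(1)[OF H] by (simp add: gt_patterns_def toggle_other)
qed

lemma toggle_involution:
  assumes "H \<in> gt_patterns N nu"
  shows "toggle j k (toggle j k H) = H"
proof (intro ext)
  fix m r
  have *: "bk_lower j k (toggle j k H) = bk_lower j k H" "bk_upper k (toggle j k H) = bk_upper k H"
    by (simp_all add: bk_lower_def bk_upper_def toggle_other fun_eq_iff split: nat.split)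
  show "toggle j k (toggle j k H) m r = H m r"
  proof (cases "m = Suc k \<and> j \<le> H (Suc k) r")
    case True
    then have "j \<le> toggle j k H (Suc k) r"
      using toggle_bounds(1)[OF assms, of j k r] by (simp add: bk_lower_def)
    then have "toggle j k (toggle j k H) (Suc k) r
        = bk_lower j k H r + bk_upper k H r - toggle j k H (Suc k) r"
      by (subst toggle_def) (simp add: *)
    then show ?thesis using True toggle_bounds(3)[OF assms, of j k r] by simp
  next
    case False
    then show ?thesis by (auto simp: toggle_def)
  qed
qed

lemma clip_toggle:
  assumes "H \<in> gt_patterns N nu" "i \<le> j"
  shows "clip i (toggle j k H) = clip i H"
proof (intro ext)
  fix m r
  show "clip i (toggle j k H) m r = clip i H m r"
  proof (cases "m = Suc k \<and> j \<le> H (Suc k) r")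
    case True
    then show ?thesis using toggle_bounds(1)[OF assms(1), of j k r] assms(2)
      by (simp add: clip_def bk_lower_def)
  next
    case False
    then show ?thesis by (auto simp: clip_def toggle_def)
  qed
qed

text \<open>Each maximum pairs up with the minimum of the next row, and \<open>max a b + min a b = a + b\<close>.\<close>
lemma sum_interlacing:
  fixes x y :: "nat \<Rightarrow> nat"
  shows "(\<Sum>r<Suc R. int (max (x (Suc r)) (y r)) +
                  int (case r of 0 \<Rightarrow> x 0 | Suc r' \<Rightarrow> min (x r) (y r')))
    = (\<Sum>r<R. int (x r) + int (y r)) + int (x R) + int (max (x (Suc R)) (y R))"
  by (induction R) auto

text \<open>The hypothesis says that column \<open>j - 1\<close> contains no letter \<open>k + 1\<close>. It ensures that the rows that the
  toggle skips satisfy the reflection formula too, both sides being \<open>2 j\<close>; so the reflected entry and the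
  old one add up to the two interval ends in every row.\<close>
lemma toggle_level_sum:
  assumes H: "H \<in> gt_patterns N nu"
    and left: "\<And>r. H (Suc k) r < j \<Longrightarrow> H (Suc (Suc k)) r < j"
    and R: "Suc (Suc k) < R"
  shows "(\<Sum>r<R. int (max j (toggle j k H (Suc k) r)) + int (max j (H (Suc k) r)))
       = (\<Sum>r<R. int (max j (H (Suc (Suc k)) r)) + int (max j (H k r)))"
proof -
  define x where "x r = max j (H (Suc (Suc k)) r)" for r
  define y where "y r = max j (H k r)" for r
  \<comment> \<open>In every row the old and the new entry add up to the ends of the interval.\<close>
  have row: "int (max j (toggle j k H (Suc k) r)) + int (max j (H (Suc k) r)) =
    int (max (x (Suc r)) (y r)) + int (case r of 0 \<Rightarrow> x 0 | Suc r' \<Rightarrow> min (x r) (y r'))" for r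
  proof (cases "j \<le> H (Suc k) r")
    case True
    have "int (max j (toggle j k H (Suc k) r)) + int (max j (H (Suc k) r))
        = int (toggle j k H (Suc k) r + H (Suc k) r)"
      using True toggle_bounds(1)[OF H True] by (simp add: bk_lower_def)
    also have "\<dots> = int (bk_lower j k H r + bk_upper k H r)"
      using toggle_bounds(3)[OF H True] by simp
    also have "bk_lower j k H r = max (x (Suc r)) (y r)" by (simp add: bk_lower_def x_def y_def)
    also have "bk_upper k H r = (case r of 0 \<Rightarrow> x 0 | Suc r' \<Rightarrow> min (x r) (y r'))"
      using order_trans[OF True le_bk_upper[OF H]]
      by (auto simp: bk_upper_def x_def y_def split: nat.splits)
    finally show ?thesis by simp
  next
    case False
    then have *: "H (Suc k) r < j" "H (Suc (Suc k)) r < j" using left by auto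
    then have "x r = j" "x (Suc r) = j" "y r = j"
      using gtD(2)[OF H, of "Suc k" r] gtD(3)[OF H, of k r] by (auto simp: x_def y_def)
    moreover have "j \<le> y r'" for r' by (simp add: y_def)
    ultimately show ?thesis using * by (auto simp: toggle_left split: nat.splits)
  qed
  obtain Q where Q: "R = Suc Q" "Suc k < Q" using R by (cases R) auto
  have "x (Suc Q) = j" "y Q = j" using Q gt_zero[OF H] by (auto simp: x_def y_def)
  then have "(\<Sum>r<R. int (max j (toggle j k H (Suc k) r)) + int (max j (H (Suc k) r)))
      = (\<Sum>r<Suc Q. int (x r) + int (y r))"
    unfolding row Q(1) sum_interlacing by simp
  then show ?thesis by (simp add: Q(1) x_def y_def)
qed

lemma max_eq_diff_min: "int (max j a) = int a + int j - int (min j a)"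
  by (simp add: max_def min_def)

lemma weight_right:
  assumes H: "H \<in> gt_patterns N nu" and "m < R"
  shows "weight H m - weight (clip j H) m = (\<Sum>r<R. int (max j (H (Suc m) r)) - int (max j (H m r)))"
  unfolding weight_rows[OF assms] weight_rows[OF clip_gt[OF H] assms(2)] sum_subtractf[symmetric]
  by (intro sum.cong) (simp_all add: clip_def max_eq_diff_min)

text \<open>The columns before \<open>j\<close> keep their weight; on the remaining ones the multiplicities of \<open>k\<close> and
  \<open>k + 1\<close> are exchanged, since the reflection replaces the level sum by the sum of the two neighbouring
  level sums minus itself.\<close>
lemma weight_toggle:
  assumes H: "H \<in> gt_patterns N nu" and k: "Suc k < N"
    and left: "\<And>r. H (Suc k) r < j \<Longrightarrow> H (Suc (Suc k)) r < j"
  defines "t \<equiv> transpose k (Suc k)"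
  shows "weight (toggle j k H) m = weight (clip j H) m + (weight H (t m) - weight (clip j H) (t m))"
proof -
  define R where "R = Suc (Suc (Suc (k + m)))"
  let ?T = "toggle j k H"
  let ?M = "\<lambda>H m r. int (max j (H m r))"
  have T: "?T \<in> gt_patterns N nu" using toggle_in_gt[OF H k] .
  have right: "weight ?T m - weight (clip j H) m = (\<Sum>r<R. ?M ?T (Suc m) r - ?M ?T m r)"
    using weight_right[OF T, of m R j] clip_toggle[OF H order_refl] by (simp add: R_def)
  have bal: "(\<Sum>r<R. ?M ?T (Suc k) r) + (\<Sum>r<R. ?M H (Suc k) r)
      = (\<Sum>r<R. ?M H (Suc (Suc k)) r) + (\<Sum>r<R. ?M H k r)"
    using toggle_level_sum[OF H left, of R] by (simp add: R_def sum.distrib)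
  consider "m = k" | "m = Suc k" | "m \<noteq> k" "m \<noteq> Suc k" by blast
  then have "weight ?T m - weight (clip j H) m = weight H (t m) - weight (clip j H) (t m)"
  proof cases
    case 1
    then have "t m = Suc k" by (simp add: t_def)
    moreover have "weight H (Suc k) - weight (clip j H) (Suc k)
        = (\<Sum>r<R. ?M H (Suc (Suc k)) r - ?M H (Suc k) r)"
      using weight_right[OF H, of "Suc k" R j] by (simp add: R_def)
    ultimately show ?thesis using bal right 1 by (simp add: toggle_other sum_subtractf)
  next
    case 2
    then have "t m = k" by (simp add: t_def)
    moreover have "weight H k - weight (clip j H) k = (\<Sum>r<R. ?M H (Suc k) r - ?M H k r)"
      using weight_right[OF H, of k R j] by (simp add: R_def)
    ultimately show ?thesis using bal right 2 by (simp add: toggle_other sum_subtractf)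
  next
    case 3
    then have "t m = m" by (simp add: t_def)
    moreover have "weight H m - weight (clip j H) m = (\<Sum>r<R. ?M H (Suc m) r - ?M H m r)"
      using weight_right[OF H, of m R j] by (simp add: R_def)
    ultimately show ?thesis using right 3 by (simp add: toggle_other)
  qed
  then show ?thesis by linarith
qed

section \<open>Cancellation over patterns\<close>

text \<open>The lattice word condition, read column by column: subtracting the contents of the columns of the
  tableau from \<open>lam\<close> one after the other never destroys the weakly decreasing order.\<close>
definition yamanouchi :: "nat \<Rightarrow> (nat \<Rightarrow> int) \<Rightarrow> (nat \<Rightarrow> nat \<Rightarrow> nat) \<Rightarrow> bool" where
  "yamanouchi N lam H \<longleftrightarrow> (\<forall>j. decreasing N (\<lambda>m. lam m - weight (clip j H) m))"

definition bad_column :: "nat \<Rightarrow> (nat \<Rightarrow> int) \<Rightarrow> (nat \<Rightarrow> nat \<Rightarrow> nat) \<Rightarrow> nat" where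
  "bad_column N lam H = (LEAST j. \<not> decreasing N (\<lambda>m. lam m - weight (clip j H) m))"

definition bad_letter :: "nat \<Rightarrow> (nat \<Rightarrow> int) \<Rightarrow> nat" where
  "bad_letter N \<alpha> = (LEAST k. Suc k < N \<and> \<alpha> k < \<alpha> (Suc k))"

lemma bad_letter:
  assumes "\<not> decreasing N \<alpha>"
  shows "Suc (bad_letter N \<alpha>) < N" "\<alpha> (bad_letter N \<alpha>) < \<alpha> (Suc (bad_letter N \<alpha>))"
  using LeastI_ex[of "\<lambda>k. Suc k < N \<and> \<alpha> k < \<alpha> (Suc k)"] assms
  by (auto simp: decreasing_def bad_letter_def not_le)

text \<open>At the first bad column the vector was still decreasing one column earlier, and a column contains
  each letter at most once. So the column before the cut contains \<open>k\<close> but not \<open>k + 1\<close>, and the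
  violation is by exactly one: \<open>\<pi> + \<rho>\<close> lies on the wall fixed by the transposition of \<open>k\<close> and \<open>k + 1\<close>.\<close>
lemma first_violation:
  assumes H: "H \<in> gt_patterns N nu" and lam: "decreasing N lam" and bad: "\<not> yamanouchi N lam H"
  defines "j \<equiv> bad_column N lam H"
  defines "\<pi> \<equiv> \<lambda>m. lam m - weight (clip j H) m"
  defines "k \<equiv> bad_letter N \<pi>"
  shows "\<pi> (Suc k) = \<pi> k + 1" "Suc k < N" "H (Suc k) r < j \<Longrightarrow> H (Suc (Suc k)) r < j"
proof -
  have nd: "\<not> decreasing N \<pi>"
    unfolding \<pi>_def j_def bad_column_def
    by (rule LeastI_ex[of "\<lambda>j. \<not> decreasing N (\<lambda>m. lam m - weight (clip j H) m)"])
       (use bad in \<open>auto simp: yamanouchi_def\<close>)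
  show k: "Suc k < N" using bad_letter(1)[OF nd] by (simp add: k_def)
  have lt: "\<pi> k < \<pi> (Suc k)" using bad_letter(2)[OF nd] by (simp add: k_def)
  have "j \<noteq> 0"
  proof
    assume "j = 0"
    then have "\<pi> = lam" by (simp add: \<pi>_def clip_0)
    with nd lam show False by simp
  qed
  then obtain i where j: "j = Suc i" by (cases j) auto
  define d where "d m = weight (clip (Suc i) H) m - weight (clip i H) m" for m
  have "decreasing N (\<lambda>m. lam m - weight (clip i H) m)"
    using not_less_Least[of i "\<lambda>j. \<not> decreasing N (\<lambda>m. lam m - weight (clip j H) m)"] j
    by (auto simp: j_def bad_column_def)
  then have "lam (Suc k) - weight (clip i H) (Suc k) \<le> lam k - weight (clip i H) k"
    using k by (simp add: decreasing_def)
  then have "\<pi> (Suc k) + d (Suc k) \<le> \<pi> k + d k"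
    by (simp add: \<pi>_def d_def j)
  moreover have "0 \<le> d (Suc k)" "d k \<le> 1"
    using column_letter_nonneg[OF H] column_letter_le_1[OF H] by (auto simp: d_def)
  ultimately have *: "d (Suc k) \<le> 0" "\<pi> (Suc k) = \<pi> k + 1" using lt by linarith+
  then show "\<pi> (Suc k) = \<pi> k + 1" by blast
  show "H (Suc (Suc k)) r < j" if "H (Suc k) r < j"
    using column_letter_absent[OF H, of i "Suc k" r] * that by (simp add: d_def j)
qed

text \<open>Stembridge's sign-reversing involution. A pattern that violates the lattice condition is toggled to
  the right of its first bad column, at the first bad letter \<open>k\<close>. This does not change the part of the
  pattern that located the violation, so it is an involution; and because the vector at the violation
  lies on a wall, the total vector moves by the dot action of a transposition, which reverses the sign
  of \<open>alt_coef\<close>.\<close>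
theorem alternating_cancellation:
  assumes f: "symmetric f" and lam: "decreasing N lam"
  shows "(\<Sum>H\<in>gt_patterns N nu. alt_coef N f (\<lambda>m. lam m - weight H m))
       = (\<Sum>H | H \<in> gt_patterns N nu \<and> yamanouchi N lam H. alt_coef N f (\<lambda>m. lam m - weight H m))"
proof -
  let ?g = "\<lambda>H. alt_coef N f (\<lambda>m. lam m - weight H m)"
  let ?B = "{H \<in> gt_patterns N nu. \<not> yamanouchi N lam H}"
  let ?j = "bad_column N lam"
  let ?\<pi> = "\<lambda>H m. lam m - weight (clip (?j H) H) m"
  let ?k = "\<lambda>H. bad_letter N (?\<pi> H)"
  define flip where "flip H = toggle (?j H) (?k H) H" for H
  have clip: "clip i (flip H) = clip i H" if "H \<in> ?B" "i \<le> ?j H" for H i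
    unfolding flip_def using clip_toggle that by blast
  have j_bad: "\<not> decreasing N (?\<pi> H)" if "H \<in> ?B" for H
    unfolding bad_column_def
    by (rule LeastI_ex[of "\<lambda>j. \<not> decreasing N (\<lambda>m. lam m - weight (clip j H) m)"])
       (use that in \<open>auto simp: yamanouchi_def\<close>)
  have flip_j: "?j (flip H) = ?j H" if H: "H \<in> ?B" for H
    unfolding bad_column_def[of _ _ "flip H"]
  proof (rule Least_equality)
    show "\<not> decreasing N (\<lambda>m. lam m - weight (clip (?j H) (flip H)) m)"
      using j_bad[OF H] clip[OF H order_refl] by simp
    fix i assume i: "\<not> decreasing N (\<lambda>m. lam m - weight (clip i (flip H)) m)"
    show "?j H \<le> i"
    proof (rule ccontr)
      assume "\<not> ?j H \<le> i"
      then have less: "i < ?j H" by simp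
      with i clip[OF H, of i] have "\<not> decreasing N (\<lambda>m. lam m - weight (clip i H) m)" by simp
      with less show False unfolding bad_column_def by (blast dest: not_less_Least)
    qed
  qed
  have flip_\<pi>: "?\<pi> (flip H) = ?\<pi> H" if "H \<in> ?B" for H
    using flip_j[OF that] clip[OF that order_refl] by simp
  have flip_B: "flip H \<in> ?B" if H: "H \<in> ?B" for H
  proof -
    have "flip H \<in> gt_patterns N nu"
      unfolding flip_def using toggle_in_gt first_violation(2)[OF _ lam] H by blast
    moreover have "\<not> yamanouchi N lam (flip H)"
      using j_bad[OF H] clip[OF H order_refl] unfolding yamanouchi_def by metis
    ultimately show ?thesis by simp
  qed
  have flip_flip: "flip (flip H) = H" if "H \<in> ?B" for H
  proof -
    have "flip (flip H) = toggle (?j H) (?k H) (flip H)"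
      unfolding flip_def[of "flip H"]
      by (rule arg_cong2[where f = "\<lambda>j k. toggle j k (flip H)"])
         (rule flip_j[OF that], rule arg_cong[OF flip_\<pi>[OF that]])
    also have "\<dots> = H" unfolding flip_def using toggle_involution that by blast
    finally show ?thesis .
  qed
  have neg: "?g (flip H) = - ?g H" if H: "H \<in> ?B" for H
  proof -
    define k where "k = ?k H"
    define \<pi> where "\<pi> = ?\<pi> H"
    let ?t = "transpose k (Suc k)"
    let ?a = "\<lambda>m. lam m - weight H m"
    have HB: "H \<in> gt_patterns N nu" "\<not> yamanouchi N lam H" using H by auto
    note v = first_violation[OF HB(1) lam HB(2), folded \<pi>_def k_def]
    have weight: "weight (flip H) m = weight (clip (?j H) H) m + (weight H (?t m) - weight (clip (?j H) H) (?t m))" for m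
      unfolding flip_def k_def[symmetric]
      by (rule weight_toggle[OF HB(1) v(2)]) (rule v(3))
    have "lam m - weight (flip H) m = ?a (?t m) - int (?t m) + int m" for m
    proof -
      have "lam m - weight (flip H) m = \<pi> m - \<pi> (?t m) + ?a (?t m)"
        by (simp add: weight \<pi>_def)
      \<comment> \<open>The wall equation says that \<open>\<pi> + \<rho>\<close> is fixed by the transposition.\<close>
      also have "\<pi> m - \<pi> (?t m) = int m - int (?t m)"
        using v(1) by (auto simp: transpose_def \<pi>_def)
      finally show ?thesis by simp
    qed
    then have "?g (flip H) = alt_coef N f (\<lambda>m. ?a (?t m) - int (?t m) + int m)" by simp
    also have "\<dots> = - ?g H" by (rule alt_coef_antisymmetric[OF f v(2)])
    finally show ?thesis .
  qed
  have "(\<Sum>H\<in>?B. ?g H) = (\<Sum>H\<in>?B. - ?g H)"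
    by (rule sum.reindex_bij_witness[where i = flip and j = flip])
       (simp_all only: flip_flip flip_B neg minus_minus)
  then have "(\<Sum>H\<in>?B. ?g H) = 0" by (simp add: sum_negf)
  moreover have "gt_patterns N nu = {H \<in> gt_patterns N nu. yamanouchi N lam H} \<union> ?B" by blast
  then have "sum ?g (gt_patterns N nu) = sum ?g {H \<in> gt_patterns N nu. yamanouchi N lam H} + sum ?g ?B"
    using sum.union_disjoint[of "{H \<in> gt_patterns N nu. yamanouchi N lam H}" ?B ?g] finite_gt[of N nu]
    by (auto simp: disjoint_iff)
  ultimately show ?thesis by simp
qed

lemma yamanouchi_final_decreasing:
  assumes "H \<in> gt_patterns N nu" "yamanouchi N lam H" "\<And>r. nu r \<le> j"
  shows "decreasing N (\<lambda>m. lam m - weight H m)"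
  using assms clip_large[OF assms(1,3)] unfolding yamanouchi_def by metis

text \<open>The tableau whose row \<open>r\<close> is filled with the letter \<open>r\<close>.\<close>
definition top_pattern :: "(nat \<Rightarrow> nat) \<Rightarrow> nat \<Rightarrow> nat \<Rightarrow> nat" where
  "top_pattern mu m r = (if r < m then mu r else 0)"

lemma weight_top_pattern: "weight (top_pattern mu) m = int (mu m)"
proof -
  have "weight (top_pattern mu) m = (\<Sum>r\<le>m. if r = m then int (mu m) else 0)"
    unfolding weight_def by (intro sum.cong) (auto simp: top_pattern_def)
  then show ?thesis by simp
qed

lemma clip_top_pattern: "clip j (top_pattern mu) = top_pattern (\<lambda>r. min j (mu r))"
  by (auto simp: clip_def top_pattern_def fun_eq_iff)

text \<open>Row by row: if the last box of row \<open>r\<close> held a letter \<open>x > r\<close>, then the columns from that box on would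
  contain \<open>x\<close>, hence by the lattice condition also \<open>r\<close>. But their boxes above row \<open>r\<close> hold smaller
  letters, and the remaining ones lie in column \<open>j\<close> from row \<open>r\<close>
  down, where all letters are at least \<open>x\<close>.\<close>
lemma yamanouchi_exhausting_unique:
  assumes H: "H \<in> gt_patterns N mu" and yamanouchi: "yamanouchi N (weight H) H"
  shows "H = top_pattern mu"
proof -
  have "\<forall>m>r. H m r = mu r" for r
  proof (induction r rule: less_induct)
    case (less r)
    have "mu r \<le> H (Suc r) r"
    proof (rule ccontr)
      assume "\<not> mu r \<le> H (Suc r) r"
      then obtain j where j: "mu r = Suc j" "H (Suc r) r \<le> j" by (cases "mu r") auto
      \<comment> \<open>The weight of the columns from \<open>j\<close> on, where column \<open>j\<close> is the last one meeting row \<open>r\<close>.\<close>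
      let ?D = "\<lambda>m. weight H m - weight (clip j H) m"
      have D: "?D m = (\<Sum>s<Suc m. int (max j (H (Suc m) s)) - int (max j (H m s)))" for m
        by (rule weight_right[OF H lessI])
      have dec: "decreasing N ?D" using yamanouchi by (simp add: yamanouchi_def)
      have D0: "?D r = 0"
        unfolding D
      proof (intro sum.neutral ballI)
        fix s assume "s \<in> {..<Suc r}"
        then consider "s < r" | "s = r" by fastforce
        then show "int (max j (H (Suc r) s)) - int (max j (H r s)) = 0"
        proof cases
          case 1
          then show ?thesis using less by simp
        next
          case 2
          then show ?thesis using gt_zero[OF H, of r r] j by simp
        qed
      qed
      \<comment> \<open>The letter in the last box of row \<open>r\<close>.\<close>
      define x where "x = (LEAST x. j < H (Suc x) r)"
      have ex: "j < H (Suc N) r" using gtD(4)[OF H, of "Suc N"] j by simp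
      have x: "j < H (Suc x) r" unfolding x_def by (rule LeastI[of _ N]) (rule ex)
      have xj: "H x r \<le> j"
      proof (cases x)
        case (Suc y)
        then show ?thesis using not_less_Least[of y "\<lambda>x. j < H (Suc x) r"]
          by (simp add: x_def[symmetric])
      qed (simp add: gtD[OF H])
      have "x < N"
      proof (rule ccontr)
        assume "\<not> x < N"
        then have "H x r = mu r" using gtD(4)[OF H] by simp
        with xj j show False by simp
      qed
      have "r \<le> x"
        using x j gt_mono[OF H, of "Suc x" "Suc r" r] by (metis Suc_le_mono le_trans linorder_not_le nle_le)
      have mono: "int (max j (H x s)) \<le> int (max j (H (Suc x) s))" for s
        by (intro of_nat_mono max.mono order_refl gtD(3)[OF H])
      have "1 \<le> int (max j (H (Suc x) r)) - int (max j (H x r))" using x xj by simp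
      also have "\<dots> \<le> ?D x"
        unfolding D using mono \<open>r \<le> x\<close>
        by (intro member_le_sum[of r "{..<Suc x}" "\<lambda>s. int (max j (H (Suc x) s)) - int (max j (H x s))"])
           auto
      finally have "1 \<le> ?D x" .
      then have "1 \<le> ?D r"
        using decreasingD[OF dec \<open>r \<le> x\<close> \<open>x < N\<close>] by linarith
      with D0 show False by linarith
    qed
    then show ?case
      using gt_mono[OF H] gt_le[OF H] by (metis Suc_leI le_antisym order_trans)
  qed
  then show ?thesis using gt_zero[OF H] by (auto simp: top_pattern_def fun_eq_iff)
qed

lemma top_pattern_gt:
  assumes "\<And>r. mu (Suc r) \<le> mu r" "\<And>r. N \<le> r \<Longrightarrow> mu r = 0"
  shows "top_pattern mu \<in> gt_patterns N mu"
  using assms by (auto simp: gt_patterns_def top_pattern_def fun_eq_iff)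

section \<open>Tableaux as patterns\<close>

definition parts :: "nat list \<Rightarrow> nat \<Rightarrow> nat" where
  "parts la r = (if r < length la then la ! r else 0)"

lemma parts_antimono:
  assumes "is_partition la"
  shows "parts la (Suc r) \<le> parts la r"
  using assms by (auto simp: parts_def is_partition_def sorted_wrt_iff_nth_less)

definition pattern_of :: "nat list list \<Rightarrow> nat \<Rightarrow> nat \<Rightarrow> nat" where
  "pattern_of T m r = (if r < length T then length (filter (\<lambda>x. x < m) (T ! r)) else 0)"

lemma sorted_nth_less_iff:
  "sorted xs \<Longrightarrow> c < length xs \<Longrightarrow> xs ! c < (m::nat) \<longleftrightarrow> c < length (filter (\<lambda>x. x < m) xs)"
proof (induction xs arbitrary: c)
  case (Cons x xs)
  have *: "filter (\<lambda>x. x < m) xs = []" if "\<not> x < m"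
    using Cons.prems(1) that by (auto simp: filter_empty_conv)
  show ?case
  proof (cases c)
    case 0
    then show ?thesis using * by simp
  next
    case (Suc d)
    then show ?thesis using Cons * by (cases "x < m") simp_all
  qed
qed simp

text \<open>In a sorted row the entries below \<open>m\<close> form an initial segment. This translates between tableau
  entries and pattern entries throughout.\<close>
lemma pattern_of_entry:
  assumes "T \<in> SSYT nu" "r < length nu" "c < nu ! r"
  shows "T ! r ! c < m \<longleftrightarrow> c < pattern_of T m r"
proof -
  have "length T = length nu" "length (T ! r) = nu ! r" "sorted (T ! r)"
    using assms by (auto simp: SSYT_def semistandard_def)
  with assms show ?thesis by (simp add: sorted_nth_less_iff pattern_of_def)
qed

lemma count_filter_less:
  "int (count (mset xs) m) = int (length (filter (\<lambda>x. x < Suc m) xs)) - int (length (filter (\<lambda>x. x < m) xs))"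
  by (induction xs) auto

lemma count_concat: "int (count (mset (concat T)) m) =
    (\<Sum>r<length T. int (pattern_of T (Suc m) r) - int (pattern_of T m r))"
proof -
  have "count (mset (concat T)) m = (\<Sum>xs\<leftarrow>T. count (mset xs) m)"
    by (induction T) simp_all
  also have "\<dots> = (\<Sum>r<length T. count (mset (T ! r)) m)"
    by (simp add: sum_list_sum_nth atLeast0LessThan)
  finally show ?thesis by (simp add: count_filter_less pattern_of_def)
qed

lemma weight_pattern_of:
  assumes "pattern_of T \<in> gt_patterns N nu"
  shows "weight (pattern_of T) m = int (count (mset (concat T)) m)"
proof -
  have "weight (pattern_of T) m =
      (\<Sum>r<max (Suc m) (length T). int (pattern_of T (Suc m) r) - int (pattern_of T m r))"
    by (rule weight_rows[OF assms]) simp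
  also have "\<dots> = int (count (mset (concat T)) m)"
    unfolding count_concat by (intro sum.mono_neutral_right) (auto simp: pattern_of_def)
  finally show ?thesis .
qed

lemma pattern_of_gt:
  assumes nu: "is_partition nu" and T: "T \<in> SSYT nu" and N: "\<And>x. x \<in> set (concat T) \<Longrightarrow> x < N"
  shows "pattern_of T \<in> gt_patterns N (parts nu)"
proof -
  have len: "length T = length nu" "\<And>r. r < length nu \<Longrightarrow> length (T ! r) = nu ! r"
    using T by (auto simp: SSYT_def)
  have le: "pattern_of T m r \<le> parts nu r" for m r
    by (simp add: pattern_of_def parts_def len[symmetric])
  have "pattern_of T (Suc m) (Suc r) \<le> pattern_of T m r" for m r
  proof (rule ccontr)
    define c where "c = pattern_of T m r"
    assume "\<not> ?thesis"
    then have c: "c < pattern_of T (Suc m) (Suc r)" by (simp add: c_def)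
    then have r: "Suc r < length nu" by (auto simp: pattern_of_def len(1) split: if_splits)
    have c': "c < nu ! Suc r" using c le[of "Suc m" "Suc r"] r by (simp add: parts_def)
    have "nu ! Suc r \<le> nu ! r" using parts_antimono[OF nu, of r] r by (simp add: parts_def)
    then have c'': "c < nu ! r" using c' by simp
    have "T ! Suc r ! c < Suc m" using pattern_of_entry[OF T r c'] c by simp
    moreover have "T ! r ! c < T ! Suc r ! c"
      using T r c' len by (simp add: SSYT_def semistandard_def)
    ultimately have "T ! r ! c < m" by simp
    then show False using pattern_of_entry[OF T _ c''] r by (simp add: c_def)
  qed
  moreover have "pattern_of T m r \<le> pattern_of T (Suc m) r" for m r
  proof -
    have "length (filter (\<lambda>x. x < m) xs) \<le> length (filter (\<lambda>x. x < Suc m) xs)" for xs :: "nat list"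
      by (induction xs) auto
    then show ?thesis by (simp add: pattern_of_def)
  qed
  moreover have "pattern_of T m = parts nu" if "N \<le> m" for m
  proof
    fix r
    have "filter (\<lambda>x. x < m) (T ! r) = T ! r" if "r < length T"
    proof (intro filter_True ballI)
      fix x assume "x \<in> set (T ! r)"
      then have "x \<in> set (concat T)" using nth_mem[OF that] by auto
      then show "x < m" using N \<open>N \<le> m\<close> by fastforce
    qed
    then show "pattern_of T m r = parts nu r" by (simp add: pattern_of_def parts_def len)
  qed
  ultimately show ?thesis by (simp add: gt_patterns_def pattern_of_def)
qed

text \<open>The entry in row \<open>r\<close> and column \<open>c\<close> is recovered as the level at which row \<open>r\<close> grows past \<open>c\<close>.\<close>
lemma pattern_of_surj:
  assumes H: "H \<in> gt_patterns N (parts nu)"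
  obtains T where "T \<in> SSYT nu" "pattern_of T = H"
proof -
  define e where "e r c = (LEAST m. c < H (Suc m) r)" for r c
  define T where "T = map (\<lambda>r. map (e r) [0..<nu ! r]) [0..<length nu]"
  have e: "e r c < m \<longleftrightarrow> c < H m r" if "c < parts nu r" for r c m
  proof
    assume "e r c < m"
    moreover have "c < H (Suc N) r" using that gtD(4)[OF H, of "Suc N"] by simp
    then have "c < H (Suc (e r c)) r" unfolding e_def by (rule LeastI)
    ultimately show "c < H m r"
      using gt_mono[OF H, of "Suc (e r c)" m r] by simp
  next
    assume c: "c < H m r"
    then obtain k where k: "m = Suc k" using gtD(1)[OF H] by (cases m) auto
    have "e r c \<le> k" unfolding e_def by (rule Least_le) (use c k in simp)
    then show "e r c < m" by (simp add: k)
  qed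
  have len: "map length T = nu" "length T = length nu"
    by (auto simp: T_def intro: nth_equalityI)
  have row: "sorted (map (e r) [0..<nu ! r])" if "r < length nu" for r
    unfolding sorted_iff_nth_mono
  proof (intro allI impI)
    fix c c' assume c: "c \<le> c'" "c' < length (map (e r) [0..<nu ! r])"
    then have b: "c < parts nu r" "c' < parts nu r" using that by (auto simp: parts_def)
    have "e r c < Suc (e r c')" using e[OF b(1)] e[OF b(2), of "Suc (e r c')"] c by simp
    then show "map (e r) [0..<nu ! r] ! c \<le> map (e r) [0..<nu ! r] ! c'"
      using c by simp
  qed
  have col: "T ! r ! c < T ! Suc r ! c" if "Suc r < length T" "c < length (T ! Suc r)" for r c
  proof -
    have "c < parts nu (Suc r)" using that by (simp add: T_def parts_def)
    moreover have "parts nu (Suc r) \<le> parts nu r"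
      using gtD(2)[OF H, of N r] gtD(4)[OF H] by simp
    ultimately have b: "c < parts nu r" "c < parts nu (Suc r)" by simp_all
    have "c < H (Suc (e (Suc r) c)) (Suc r)" using e[OF b(2)] by blast
    then have "c < H (e (Suc r) c) r" using gtD(2)[OF H] by (rule order.strict_trans2)
    then have "e r c < e (Suc r) c" using e[OF b(1)] by blast
    then show ?thesis using that b by (simp add: T_def parts_def)
  qed
  have T: "T \<in> SSYT nu"
    unfolding SSYT_def semistandard_def using len row col by (auto simp: T_def)
  have "pattern_of T m r = H m r" for m r
  proof (cases "r < length nu")
    case True
    have nth: "T ! r ! c = e r c" if "c < nu ! r" for c using True that by (simp add: T_def)
    have "c < pattern_of T m r \<longleftrightarrow> c < H m r" if "c < nu ! r" for c
      using pattern_of_entry[OF T True that] e[of c r m] nth[OF that] that True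
      by (simp add: parts_def)
    moreover have "pattern_of T m r \<le> nu ! r" "H m r \<le> nu ! r"
      using gt_le[OF H, of m r] True length_filter_le[of _ "T ! r"]
      by (auto simp: pattern_of_def len parts_def T_def intro: order_trans[OF length_filter_le])
    ultimately show ?thesis by (metis linorder_neqE_nat order.strict_trans2 order_less_irrefl)
  next
    case False
    then show ?thesis using gt_le[OF H, of m r] by (simp add: pattern_of_def len parts_def)
  qed
  then have "pattern_of T = H" by blast
  then show ?thesis using that T by blast
qed

lemma pattern_of_inj: "inj_on pattern_of (SSYT nu)"
proof
  fix T U assume T: "T \<in> SSYT nu" and U: "U \<in> SSYT nu" and eq: "pattern_of T = pattern_of U"
  have len: "length T = length nu" "length U = length nu"
    "\<And>r. r < length nu \<Longrightarrow> length (T ! r) = nu ! r" "\<And>r. r < length nu \<Longrightarrow> length (U ! r) = nu ! r"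
    using T U unfolding SSYT_def by (metis (mono_tags) length_map mem_Collect_eq nth_map)+
  have "T ! r ! c = U ! r ! c" if "r < length nu" "c < nu ! r" for r c
    using pattern_of_entry[OF T that] pattern_of_entry[OF U that] eq
    by (metis less_irrefl linorder_neqE_nat)
  then show "T = U" by (intro nth_equalityI) (auto simp: len)
qed

lemma schur_gt:
  assumes nu: "is_partition nu" and c: "set_mset c \<subseteq> {..<N}"
  shows "schur nu c = int (card {H \<in> gt_patterns N (parts nu). weight H = (\<lambda>m. int (count c m))})"
proof -
  let ?A = "{T \<in> SSYT nu. mset (concat T) = c}"
  let ?B = "{H \<in> gt_patterns N (parts nu). weight H = (\<lambda>m. int (count c m))}"
  have less: "x < N" if "T \<in> ?A" "x \<in> set (concat T)" for T x
    using that c by (metis (mono_tags, lifting) lessThan_iff mem_Collect_eq set_mset_mset subsetD)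
  have "bij_betw pattern_of ?A ?B"
    unfolding bij_betw_def
  proof
    show "inj_on pattern_of ?A" by (rule inj_on_subset[OF pattern_of_inj]) auto
    show "pattern_of ` ?A = ?B"
    proof (intro equalityI subsetI)
      fix H assume "H \<in> pattern_of ` ?A"
      then obtain T where T: "T \<in> ?A" "H = pattern_of T" by blast
      then have "H \<in> gt_patterns N (parts nu)" using pattern_of_gt[OF nu] less by blast
      then show "H \<in> ?B" using T weight_pattern_of by auto
    next
      fix H assume H: "H \<in> ?B"
      then obtain T where T: "T \<in> SSYT nu" "pattern_of T = H" using pattern_of_surj by blast
      have "int (count (mset (concat T)) m) = int (count c m)" for m
        using H T weight_pattern_of[of T N "parts nu" m] by simp
      then have "mset (concat T) = c" by (simp add: multiset_eq_iff)
      with T show "H \<in> pattern_of ` ?A" by blast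
    qed
  qed
  then show ?thesis by (simp add: schur_def bij_betw_same_card)
qed

lemma content_exists:
  assumes "H \<in> gt_patterns N nu"
  obtains c where "weight H = (\<lambda>m. int (count c m))"
proof -
  have "{m. weight H m \<noteq> 0} \<subseteq> {..<N}" using weight_beyond[OF assms] by (auto simp: not_less[symmetric])
  then have "finite {m. weight H m \<noteq> 0}" by (rule finite_subset) simp
  then have "finite {m. 0 < nat (weight H m)}" by (rule rev_finite_subset) auto
  then have "weight H m = int (count (Abs_multiset (\<lambda>m. nat (weight H m))) m)" for m
    using weight_nonneg[OF assms] by (simp add: count_Abs_multiset)
  then show ?thesis using that by blast
qed

lemma mseries_mult_sub:
  "mseries_mult f g a = (\<Sum>c | c \<subseteq># a. f (a - c) * g c)"
  unfolding mseries_mult_def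
  by (rule sum.reindex_bij_witness[where i = "\<lambda>c. (a - c, c)" and j = snd]) auto

lemma finite_sub_mset: "finite {c. c \<subseteq># (a :: 'a multiset)}"
  by (rule finite_subset[of _ "snd ` {(b, c). b + c = a}"])
     (auto intro!: finite_imageI finite_mset_splittings simp: image_iff, metis subset_mset.diff_add)

text \<open>Multiplying by \<open>s\<^sub>\<nu>\<close> means subtracting the weight of a tableau of shape \<open>\<nu>\<close> in all possible ways.\<close>
lemma coef_mult_schur:
  assumes nu: "is_partition nu" and \<alpha>: "\<And>i. N \<le> i \<Longrightarrow> \<alpha> i = 0"
  shows "coef (mseries_mult f (schur nu)) \<alpha> = (\<Sum>H\<in>gt_patterns N (parts nu). coef f (\<lambda>i. \<alpha> i - weight H i))"
proof (cases \<alpha> rule: exponent_cases)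
  case (1 a)
  have a: "set_mset a \<subseteq> {..<N}"
  proof
    fix i assume "i \<in># a"
    then have "\<alpha> i \<noteq> 0" using 1 by simp
    then show "i \<in> {..<N}" using \<alpha> by (meson lessThan_iff not_le)
  qed
  let ?G = "gt_patterns N (parts nu)"
  let ?c = "\<lambda>H. Abs_multiset (\<lambda>i. nat (weight H i))"
  have cont: "weight H = (\<lambda>m. int (count (?c H) m))" if H: "H \<in> ?G" for H
  proof -
    obtain c where "weight H = (\<lambda>m. int (count c m))" using content_exists[OF H] .
    then show ?thesis by (simp add: count_inverse)
  qed
  have cont_iff: "weight H = (\<lambda>m. int (count c m)) \<longleftrightarrow> ?c H = c" if "H \<in> ?G" for H c
    using cont[OF that] by (metis (no_types, lifting) count_inverse nat_int ext)
  have "coef (mseries_mult f (schur nu)) \<alpha> = (\<Sum>c | c \<subseteq># a. f (a - c) * schur nu c)"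
    by (simp only: 1 coef_count mseries_mult_sub)
  also have "\<dots> = (\<Sum>c | c \<subseteq># a. \<Sum>H | H \<in> {H \<in> ?G. ?c H \<subseteq># a} \<and> ?c H = c. f (a - ?c H))"
  proof (intro sum.cong refl)
    fix c assume "c \<in> {c. c \<subseteq># a}"
    then have c: "c \<subseteq># a" "set_mset c \<subseteq> {..<N}" using a set_mset_mono by blast+
    have "{H \<in> ?G. weight H = (\<lambda>m. int (count c m))} = {H. H \<in> {H \<in> ?G. ?c H \<subseteq># a} \<and> ?c H = c}"
      by (auto simp: cont_iff c(1))
    then show "f (a - c) * schur nu c =
        (\<Sum>H | H \<in> {H \<in> ?G. ?c H \<subseteq># a} \<and> ?c H = c. f (a - ?c H))"
      by (simp add: schur_gt[OF nu c(2)])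
  qed
  also have "\<dots> = (\<Sum>H | H \<in> ?G \<and> ?c H \<subseteq># a. f (a - ?c H))"
    by (rule sum.group) (auto simp: finite_sub_mset finite_gt)
  also have "\<dots> = (\<Sum>H\<in>?G. if ?c H \<subseteq># a then f (a - ?c H) else 0)"
    by (simp add: sum.inter_filter finite_gt)
  also have "\<dots> = (\<Sum>H\<in>?G. coef f (\<lambda>i. \<alpha> i - weight H i))"
  proof (intro sum.cong refl)
    fix H assume "H \<in> ?G"
    then have "(\<lambda>i. \<alpha> i - weight H i) = (\<lambda>i. int (count a i) - int (count (?c H) i))"
      using cont 1 by metis
    then show "(if ?c H \<subseteq># a then f (a - ?c H) else 0) = coef f (\<lambda>i. \<alpha> i - weight H i)"
      by (simp only: coef_diff_count)
  qed
  finally show ?thesis .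
next
  case 2
  have "coef f (\<lambda>i. \<alpha> i - weight H i) = 0" if H: "H \<in> gt_patterns N (parts nu)" for H
  proof (rule ccontr)
    assume *: "coef f (\<lambda>i. \<alpha> i - weight H i) \<noteq> 0"
    obtain c where c: "weight H = (\<lambda>m. int (count c m))" using content_exists[OF H] .
    obtain b where "(\<lambda>i. \<alpha> i - weight H i) = (\<lambda>i. int (count b i))"
      using * by (cases "\<lambda>i. \<alpha> i - weight H i" rule: exponent_cases) auto
    then have "\<alpha> = (\<lambda>i. int (count (b + c) i))"
      using c by (auto simp: fun_eq_iff algebra_simps)
    then have "coef (\<lambda>_. 1) \<alpha> = 1" by (simp only: coef_count)
    with 2 show False by simp
  qed
  with 2 show ?thesis by simp
qed

section \<open>Products with Schur functions\<close>

lemma mseries_mult_one: "mseries_mult one g = g"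
proof
  fix a
  have "mseries_mult one g a = (\<Sum>c | c \<subseteq># a. if c = a then g a else 0)"
    unfolding mseries_mult_sub
    by (intro sum.cong) (auto simp: one_def Diff_eq_empty_iff_mset subset_mset.antisym)
  also have "\<dots> = g a" using finite_sub_mset[of a] by simp
  finally show "mseries_mult one g a = g a" .
qed

text \<open>For \<open>j = 0\<close> the toggle acts on the whole tableau and transposes its weight.\<close>
lemma symmetric_mult_schur:
  assumes f: "symmetric f" and nu: "is_partition nu"
  shows "symmetric (mseries_mult f (schur nu))"
  unfolding symmetric_def
proof (intro allI)
  fix k and a :: "nat multiset"
  let ?t = "transpose k (Suc k)"
  let ?\<alpha> = "\<lambda>i. int (count a i)"
  define N where "N = Suc (Max (insert (Suc k) (set_mset a)))"
  have lt: "i < N" if "i \<in> insert (Suc k) (set_mset a)" for i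
    unfolding N_def less_Suc_eq_le by (rule Max_ge) (use that in auto)
  then have k: "Suc k < N" by simp
  have \<alpha>: "?\<alpha> i = 0" "(?\<alpha> \<circ> ?t) i = 0" if "N \<le> i" for i
  proof -
    have "i \<noteq> k" "i \<noteq> Suc k" using that k by auto
    moreover show "?\<alpha> i = 0" using that lt[of i] by (auto simp: count_eq_zero_iff)
    ultimately show "(?\<alpha> \<circ> ?t) i = 0" by simp
  qed
  let ?G = "gt_patterns N (parts nu)"
  have "mseries_mult f (schur nu) (image_mset ?t a)
      = coef (mseries_mult f (schur nu)) (\<lambda>i. int (count (image_mset ?t a) i))"
    by (rule coef_count[symmetric])
  also have "(\<lambda>i. int (count (image_mset ?t a) i)) = ?\<alpha> \<circ> ?t"
    by (simp only: count_image_transpose comp_def)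
  also have "coef (mseries_mult f (schur nu)) (?\<alpha> \<circ> ?t)
      = (\<Sum>H\<in>?G. coef f (\<lambda>i. (?\<alpha> \<circ> ?t) i - weight H i))"
    by (rule coef_mult_schur[OF nu \<alpha>(2)])
  also have "\<dots> = (\<Sum>H\<in>?G. coef f (\<lambda>i. ?\<alpha> i - weight H i))"
  proof (rule sum.reindex_bij_witness[where i = "toggle 0 k" and j = "toggle 0 k"])
    fix H assume H: "H \<in> ?G"
    show "toggle 0 k (toggle 0 k H) = H" by (rule toggle_involution[OF H])
    then show "toggle 0 k (toggle 0 k H) = H" .
    show T: "toggle 0 k H \<in> ?G" by (rule toggle_in_gt[OF H k])
    then show "toggle 0 k H \<in> ?G" .
    have "weight (toggle 0 k H) m = weight H (?t m)" for m
      using weight_toggle[OF H k, of 0 m] by (simp add: clip_0)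
    then have "(\<lambda>i. (?\<alpha> \<circ> ?t) i - weight H i) = (\<lambda>i. ?\<alpha> i - weight (toggle 0 k H) i) \<circ> ?t"
      by (simp add: fun_eq_iff)
    then show "coef f (\<lambda>i. ?\<alpha> i - weight (toggle 0 k H) i) = coef f (\<lambda>i. (?\<alpha> \<circ> ?t) i - weight H i)"
      by (simp only: symmetric_coef[OF f])
  qed
  also have "\<dots> = coef (mseries_mult f (schur nu)) ?\<alpha>"
    by (rule coef_mult_schur[OF nu \<alpha>(1), symmetric])
  also have "\<dots> = mseries_mult f (schur nu) a" by (rule coef_count)
  finally show "mseries_mult f (schur nu) (image_mset ?t a) = mseries_mult f (schur nu) a" .
qed

lemma symmetric_schur: "is_partition nu \<Longrightarrow> symmetric (schur nu)"
  using symmetric_mult_schur[OF symmetric_one] by (simp add: mseries_mult_one)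

text \<open>A Littlewood-Richardson rule. Taking \<open>f = s\<^sub>\<mu>\<close>, the remaining summands are \<open>0\<close> or \<open>1\<close>, since the
  vectors left over by lattice patterns are decreasing.\<close>
lemma alt_coef_mult_schur:
  assumes f: "symmetric f" and nu: "is_partition nu"
    and lam: "decreasing N lam" "\<And>i. N \<le> i \<Longrightarrow> lam i = 0"
  shows "alt_coef N (mseries_mult f (schur nu)) lam =
    (\<Sum>H | H \<in> gt_patterns N (parts nu) \<and> yamanouchi N lam H. alt_coef N f (\<lambda>m. lam m - weight H m))"
proof -
  let ?G = "gt_patterns N (parts nu)"
  have "alt_coef N (mseries_mult f (schur nu)) lam = (\<Sum>w | w permutes {..<N}.
      \<Sum>H\<in>?G. sign w * coef f (\<lambda>i. (lam i - weight H i) - int i + int (w i)))"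
    unfolding alt_coef_def
  proof (intro sum.cong refl)
    fix w assume "w \<in> {w. w permutes {..<N}}"
    then have "lam i - int i + int (w i) = 0" if "N \<le> i" for i
      using that lam(2) by (simp add: permutes_def)
    then have "coef (mseries_mult f (schur nu)) (\<lambda>i. lam i - int i + int (w i)) =
        (\<Sum>H\<in>?G. coef f (\<lambda>i. (lam i - int i + int (w i)) - weight H i))"
      by (rule coef_mult_schur[OF nu])
    also have "\<dots> = (\<Sum>H\<in>?G. coef f (\<lambda>i. (lam i - weight H i) - int i + int (w i)))"
      by (simp add: algebra_simps)
    finally show "sign w * coef (mseries_mult f (schur nu)) (\<lambda>i. lam i - int i + int (w i)) =
        (\<Sum>H\<in>?G. sign w * coef f (\<lambda>i. (lam i - weight H i) - int i + int (w i)))"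
      by (simp add: sum_distrib_left)
  qed
  also have "\<dots> = (\<Sum>H\<in>?G. alt_coef N f (\<lambda>m. lam m - weight H m))"
    unfolding alt_coef_def by (rule sum.swap)
  also have "\<dots> = (\<Sum>H | H \<in> ?G \<and> yamanouchi N lam H. alt_coef N f (\<lambda>m. lam m - weight H m))"
    by (rule alternating_cancellation[OF f lam(1)])
  finally show ?thesis .
qed

lemma parts_le_sum: "parts la r \<le> sum_list la"
  by (simp add: parts_def member_le_sum_list)

lemma yamanouchi_residue:
  assumes "H \<in> gt_patterns N (parts nu)" "yamanouchi N lam H" "\<And>i. N \<le> i \<Longrightarrow> lam i = 0"
  shows "decreasing N (\<lambda>m. lam m - weight H m)" "N \<le> i \<Longrightarrow> lam i - weight H i = 0"
  using yamanouchi_final_decreasing[OF assms(1,2) parts_le_sum] weight_beyond[OF assms(1)] assms(3) by auto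

text \<open>Apply the rule to \<open>1 \<cdot> s\<^sub>\<mu>\<close>: a lattice pattern must use up \<open>lam\<close> completely, and only the top pattern
  does.\<close>
lemma alt_coef_schur:
  assumes mu: "is_partition mu" "length mu \<le> N"
    and lam: "decreasing N lam" "\<And>i. N \<le> i \<Longrightarrow> lam i = 0"
  shows "alt_coef N (schur mu) lam = (if lam = (\<lambda>i. int (parts mu i)) then 1 else 0)"
proof -
  let ?S = "{H. H \<in> gt_patterns N (parts mu) \<and> yamanouchi N lam H}"
  let ?top = "top_pattern (parts mu)"
  have top_gt: "?top \<in> gt_patterns N (parts mu)"
    using parts_antimono[OF mu(1)] mu(2) by (intro top_pattern_gt) (auto simp: parts_def)
  have top_yamanouchi: "yamanouchi N (\<lambda>i. int (parts mu i)) ?top"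
    using parts_antimono[OF mu(1)]
    by (auto simp: yamanouchi_def decreasing_def clip_top_pattern weight_top_pattern min_def
        intro: order_trans)
  have "alt_coef N (schur mu) lam = (\<Sum>H\<in>?S. alt_coef N one (\<lambda>m. lam m - weight H m))"
    using alt_coef_mult_schur[OF symmetric_one mu(1) lam] by (simp add: mseries_mult_one)
  also have "\<dots> = (\<Sum>H\<in>?S. if H = ?top \<and> lam = (\<lambda>i. int (parts mu i)) then 1 else 0)"
  proof (intro sum.cong refl)
    fix H assume H: "H \<in> ?S"
    then have "alt_coef N one (\<lambda>m. lam m - weight H m) = (if (\<lambda>m. lam m - weight H m) = (\<lambda>i. 0) then 1 else 0)"
      using yamanouchi_residue lam(2) by (intro alt_coef_one) blast+
    moreover have "(\<lambda>m. lam m - weight H m) = (\<lambda>i. 0) \<longleftrightarrow> H = ?top \<and> lam = (\<lambda>i. int (parts mu i))"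
    proof
      assume "(\<lambda>m. lam m - weight H m) = (\<lambda>i. 0)"
      then have eq: "lam = weight H" by (simp add: fun_eq_iff)
      then have "H = ?top" using H yamanouchi_exhausting_unique by blast
      with eq show "H = ?top \<and> lam = (\<lambda>i. int (parts mu i))"
        using weight_top_pattern by blast
    qed (simp add: weight_top_pattern)
    ultimately show "alt_coef N one (\<lambda>m. lam m - weight H m) =
        (if H = ?top \<and> lam = (\<lambda>i. int (parts mu i)) then 1 else 0)" by simp
  qed
  also have "\<dots> = (if lam = (\<lambda>i. int (parts mu i)) then 1 else 0)"
  proof (cases "lam = (\<lambda>i. int (parts mu i))")
    case True
    then have "?top \<in> ?S" using top_gt top_yamanouchi by simp
    moreover have "finite ?S" using finite_gt by simp
    ultimately show ?thesis using True by simp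
  qed simp
  finally show ?thesis .
qed

lemma alt_coef_mult_schur_nonneg:
  assumes "is_partition mu" "length mu \<le> N" "is_partition nu"
    and "decreasing N lam" "\<And>i. N \<le> i \<Longrightarrow> lam i = 0"
  shows "0 \<le> alt_coef N (mseries_mult (schur mu) (schur nu)) lam"
proof -
  have "0 \<le> alt_coef N (schur mu) (\<lambda>m. lam m - weight H m)"
    if "H \<in> {H \<in> gt_patterns N (parts nu). yamanouchi N lam H}" for H
  proof -
    have H: "H \<in> gt_patterns N (parts nu)" "yamanouchi N lam H" using that by auto
    have "alt_coef N (schur mu) (\<lambda>m. lam m - weight H m) =
      (if (\<lambda>m. lam m - weight H m) = (\<lambda>i. int (parts mu i)) then 1 else 0)"
      using yamanouchi_residue[OF H assms(5)] by (intro alt_coef_schur assms(1,2)) blast+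
    then show ?thesis by simp
  qed
  then have "0 \<le> (\<Sum>H | H \<in> gt_patterns N (parts nu) \<and> yamanouchi N lam H. alt_coef N (schur mu) (\<lambda>m. lam m - weight H m))"
    by (rule sum_nonneg)
  then show ?thesis
    using alt_coef_mult_schur[OF symmetric_schur[OF assms(1)] assms(3,4)] assms(5) by simp
qed

section \<open>Schur functions as a basis\<close>

definition homogeneous :: "nat \<Rightarrow> mseries \<Rightarrow> bool" where
  "homogeneous n f \<longleftrightarrow> (\<forall>a. f a \<noteq> 0 \<longrightarrow> size a = n)"

lemma homogeneous_schur: "homogeneous (sum_list la) (schur la)"
  unfolding homogeneous_def
proof (intro allI impI)
  fix a assume "schur la a \<noteq> 0"
  then obtain T where "T \<in> SSYT la" "mset (concat T) = a"
    unfolding schur_def by (metis (mono_tags, lifting) Collect_empty_eq card.empty of_nat_0)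
  then show "size a = sum_list la" by (auto simp: SSYT_def length_concat)
qed

lemma homogeneous_mult:
  assumes "homogeneous k f" "homogeneous l g"
  shows "homogeneous (k + l) (mseries_mult f g)"
  unfolding homogeneous_def
proof (intro allI impI)
  fix a assume "mseries_mult f g a \<noteq> 0"
  then obtain c where "c \<subseteq># a" "f (a - c) * g c \<noteq> 0"
    unfolding mseries_mult_sub by (metis (mono_tags, lifting) mem_Collect_eq sum.not_neutral_contains_not_neutral)
  moreover from this have "size (a - c) = k" "size c = l"
    using assms by (auto simp: homogeneous_def)
  ultimately show "size a = k + l" by (metis size_union subset_mset.diff_add)
qed

lemma parts_inj:
  assumes "is_partition la" "is_partition ka" "parts la = parts ka"
  shows "la = ka"
proof -
  have pos: "parts la r \<noteq> 0 \<longleftrightarrow> r < length la" if "is_partition la" for la r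
  proof
    assume "r < length la"
    then have "la ! r \<in> set la" by simp
    then have "la ! r \<noteq> 0" using that by (metis is_partition_def)
    then show "parts la r \<noteq> 0" using \<open>r < length la\<close> by (simp add: parts_def)
  qed (simp add: parts_def split: if_splits)
  then have "{..<length la} = {r. parts la r \<noteq> 0}" if "is_partition la" for la
    using that by blast
  from this[OF assms(1)] this[OF assms(2)] have "{..<length la} = {..<length ka}"
    by (simp only: assms(3))
  then have "length la = length ka" by simp
  moreover have "la ! r = ka ! r" if "r < length la" "r < length ka" for r
    using fun_cong[OF assms(3), of r] that by (simp add: parts_def)
  ultimately show ?thesis by (simp add: nth_equalityI)
qed

lemma partition_of_parts:
  assumes anti: "\<And>i. g (Suc i) \<le> g i" and zero: "\<And>i. n \<le> i \<Longrightarrow> g i = 0"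
  obtains la where "is_partition la" "parts la = g" "sum_list la = (\<Sum>i<n. g i)"
proof
  define M where "M = (LEAST i. g i = 0)"
  define la where "la = map g [0..<M]"
  have mono: "g j \<le> g i" if "i \<le> j" for i j
    using that by (induction j rule: dec_induct) (auto intro: order_trans anti)
  have M0: "g M = 0" unfolding M_def by (rule LeastI[of _ n]) (simp add: zero)
  have Mn: "M \<le> n" unfolding M_def by (rule Least_le) (simp add: zero)
  have pos: "g i \<noteq> 0" if "i < M" for i using that not_less_Least unfolding M_def by blast
  have beyond: "g i = 0" if "M \<le> i" for i using mono[OF that] M0 by simp
  show "is_partition la"
    using pos mono by (force simp: la_def is_partition_def sorted_wrt_iff_nth_less)
  show "parts la = g" using beyond by (auto simp: parts_def la_def fun_eq_iff)
  have "sum_list la = (\<Sum>i<M. g i)" by (simp add: la_def sum_list_distinct_conv_sum_set atLeast0LessThan)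
  also have "\<dots> = (\<Sum>i<n. g i)" using Mn beyond by (intro sum.mono_neutral_left) auto
  finally show "sum_list la = (\<Sum>i<n. g i)" .
qed

lemma length_partition_le: "la \<in> partitions_of n \<Longrightarrow> length la \<le> n"
proof -
  have "0 \<notin> set la \<Longrightarrow> length la \<le> sum_list la" for la :: "nat list"
    by (induction la) auto
  then show "la \<in> partitions_of n \<Longrightarrow> length la \<le> n"
    by (auto simp: partitions_of_def is_partition_def)
qed

lemma parts_dominant:
  assumes "is_partition la" "length la \<le> N"
  shows "decreasing N (\<lambda>i. int (parts la i))" "N \<le> i \<Longrightarrow> int (parts la i) = 0"
  using assms parts_antimono[OF assms(1)] by (auto simp: decreasing_def parts_def)

lemma alt_coef_schur_parts:
  assumes "is_partition la" "length la \<le> N" "is_partition ka" "length ka \<le> N"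
  shows "alt_coef N (schur la) (\<lambda>i. int (parts ka i)) = (if la = ka then 1 else 0)"
proof -
  have "(\<lambda>i. int (parts ka i)) = (\<lambda>i. int (parts la i)) \<longleftrightarrow> la = ka"
    using parts_inj[OF assms(3,1)] by (auto simp: fun_eq_iff)
  then show ?thesis
    using alt_coef_schur[OF assms(1,2) parts_dominant[OF assms(3,4)]] by simp
qed

lemma sum_mset_as_sum:
  "set_mset a \<subseteq> {..<n} \<Longrightarrow> int (sum_mset a) = (\<Sum>i<n. int i * int (count a i))"
proof (induction a)
  case (add x a)
  have "(\<Sum>i<n. int i * int (count (add_mset x a) i)) =
      (\<Sum>i<n. int i * int (count a i)) + (\<Sum>i<n. if i = x then int x else 0)"
    unfolding sum.distrib[symmetric] by (intro sum.cong) (auto simp: algebra_simps)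
  then show ?case using add by simp
qed simp

lemma sum_mset_transpose:
  "int (sum_mset (image_mset (transpose k (Suc k)) a))
     = int (sum_mset a) + int (count a k) - int (count a (Suc k))"
  by (induction a) (auto simp: transpose_def)

lemma card_set_mset_le_size: "card (set_mset a) \<le> size a"
  by (induction a) (auto intro: le_SucI simp: card_insert_if)

text \<open>Among the monomials of \<open>f\<close> choose one, \<open>a\<close>, with the smallest sum of indices. By symmetry its exponents
  decrease, so it is a partition. Every other exponent vector \<open>a + \<rho> - w\<rho>\<close> occurring in \<open>alt_coef\<close> has a
  strictly smaller sum of indices, by the rearrangement inequality, so \<open>alt_coef\<close> reduces to the
  coefficient at \<open>a\<close>.\<close>
lemma symmetric_zero:
  assumes sym: "symmetric f" and hom: "homogeneous n f"
    and zero: "\<And>la. la \<in> partitions_of n \<Longrightarrow> alt_coef n f (\<lambda>i. int (parts la i)) = 0"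
  shows "f a = 0"
proof (rule ccontr)
  assume "f a \<noteq> 0"
  then obtain a where fa: "f a \<noteq> 0" and least: "\<And>b. f b \<noteq> 0 \<Longrightarrow> sum_mset a \<le> sum_mset b"
    using ex_has_least_nat[of "\<lambda>a. f a \<noteq> 0" a sum_mset] by blast
  have anti: "count a (Suc k) \<le> count a k" for k
  proof (rule ccontr)
    assume *: "\<not> ?thesis"
    have "f (image_mset (transpose k (Suc k)) a) \<noteq> 0" using fa sym by (simp add: symmetric_def)
    from least[OF this] * show False using sum_mset_transpose[of k a] by linarith
  qed
  have size: "size a = n" using fa hom by (simp add: homogeneous_def)
  have supp: "set_mset a \<subseteq> {..<n}"
  proof
    fix i assume "i \<in># a"
    then have "0 < count a i" by simp
    moreover have "count a i \<le> count a j" if "j \<le> i" for j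
      using that by (induction i rule: dec_induct) (auto intro: order_trans anti)
    ultimately have "{..i} \<subseteq> set_mset a" by (metis atMost_iff count_greater_zero_iff order.strict_trans2 subsetI)
    then have "card {..i} \<le> card (set_mset a)" by (intro card_mono) auto
    then show "i \<in> {..<n}" using card_set_mset_le_size[of a] size by simp
  qed
  have out: "count a i = 0" if "n \<le> i" for i
    using that supp by (auto simp: count_eq_zero_iff)
  obtain la where la: "is_partition la" "parts la = count a" "sum_list la = (\<Sum>i<n. count a i)"
    using partition_of_parts[of "count a" n] anti out by blast
  have "(\<Sum>i<n. count a i) = size a"
    unfolding size_multiset_overloaded_eq
    using supp by (intro sum.mono_neutral_right) (auto simp: count_eq_zero_iff)
  with la size have "la \<in> partitions_of n" by (simp add: partitions_of_def)
  then have "0 = alt_coef n f (\<lambda>i. int (count a i))" using zero la(2) by metis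
  also have "\<dots> = (\<Sum>w | w permutes {..<n}. if w = id then f a else 0)"
    unfolding alt_coef_def
  proof (intro sum.cong refl)
    fix w assume "w \<in> {w. w permutes {..<n}}"
    then have w: "w permutes {..<n}" by simp
    let ?\<beta> = "\<lambda>i. int (count a i) - int i + int (w i)"
    have "coef f ?\<beta> = 0" if "w \<noteq> id"
    proof (rule ccontr)
      assume nz: "coef f ?\<beta> \<noteq> 0"
      then obtain b where b: "?\<beta> = (\<lambda>i. int (count b i))"
        by (cases ?\<beta> rule: exponent_cases) auto
      then have bi: "int (count b i) = int (count a i) - int i + int (w i)" for i
        using fun_cong[OF b, of i] by simp
      have "f b \<noteq> 0" using nz unfolding b coef_count .
      then have "sum_mset a \<le> sum_mset b" by (rule least)
      then have le: "int (sum_mset a) \<le> int (sum_mset b)" by (simp only: of_nat_le_iff)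
      have "set_mset b \<subseteq> {..<n}"
      proof
        fix i assume "i \<in># b"
        then have "int (count b i) \<noteq> 0" by simp
        then show "i \<in> {..<n}" using bi[of i] out[of i] permutes_not_in[OF w, of i] by fastforce
      qed
      from sum_mset_as_sum[OF this]
      have "int (sum_mset b) = (\<Sum>i<n. int i * int (count a i) - (int i * int i - int i * int (w i)))"
        by (simp add: bi algebra_simps)
      also have "\<dots> = int (sum_mset a) - (\<Sum>i<n. int i * int i - int i * int (w i))"
        using sum_mset_as_sum[OF supp] by (simp add: sum_subtractf)
      finally have "(\<Sum>i<n. int i * int i - int i * int (w i)) \<le> 0" using le by linarith
      moreover
      have "(\<Sum>i<n. int (w i) * int (w i)) = (\<Sum>i<n. int i * int i)"
        using sum.permute[OF w, of "\<lambda>i. int i * int i"] by (simp add: comp_def)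
      \<comment> \<open>Rearrangement: the loss in the index sum is half a sum of squares.\<close>
      then have "(\<Sum>i<n. (int i - int (w i))\<^sup>2) = 2 * (\<Sum>i<n. int i * int i - int i * int (w i))"
        by (simp add: power2_eq_square algebra_simps sum.distrib sum_subtractf sum_distrib_left)
      ultimately have "(\<Sum>i<n. (int i - int (w i))\<^sup>2) \<le> 0" by simp
      then have "(\<Sum>i<n. (int i - int (w i))\<^sup>2) = 0"
        by (intro antisym sum_nonneg) auto
      then have "w i = i" if "i < n" for i
        using that by (subst (asm) sum_nonneg_eq_0_iff) auto
      then have "w = id" using w by (auto simp: fun_eq_iff permutes_def)
      with that show False by simp
    qed
    moreover have "coef f ?\<beta> = f a" if "w = id" using that by (simp add: coef_count)
    ultimately show "sign w * coef f ?\<beta> = (if w = id then f a else 0)" by (simp add: sign_id)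
  qed
  also have "\<dots> = f a" by (simp add: finite_permutations permutes_id)
  finally show False using fa by simp
qed

lemma symmetric_combination:
  "(\<And>x. x \<in> A \<Longrightarrow> symmetric (F x)) \<Longrightarrow> symmetric (\<lambda>a. \<Sum>x\<in>A. c x * F x a)"
  by (simp add: symmetric_def)

text \<open>The difference of the two sides is killed by all the functionals \<open>alt_coef\<close>, because these are dual
  to the Schur functions.\<close>
theorem schur_expansion:
  assumes sym: "symmetric f" and hom: "homogeneous n f"
  shows "f a = (\<Sum>la\<in>partitions_of n. alt_coef n f (\<lambda>i. int (parts la i)) * schur la a)"
proof -
  let ?c = "\<lambda>la. alt_coef n f (\<lambda>i. int (parts la i))"
  let ?s = "\<lambda>a. \<Sum>la\<in>partitions_of n. ?c la * schur la a"
  let ?g = "\<lambda>a. f a - ?s a"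
  have part: "is_partition la" "length la \<le> n" if "la \<in> partitions_of n" for la
    using that length_partition_le by (auto simp: partitions_of_def)
  have "symmetric ?s" by (intro symmetric_combination symmetric_schur part)
  then have 1: "symmetric ?g" using sym by (simp add: symmetric_def)
  have "homogeneous n (schur la)" if "la \<in> partitions_of n" for la
    using homogeneous_schur[of la] that by (simp add: partitions_of_def)
  then have "?s a = 0" if "size a \<noteq> n" for a
    using that by (intro sum.neutral) (auto simp: homogeneous_def)
  then have 2: "homogeneous n ?g" using hom unfolding homogeneous_def by force
  have 3: "alt_coef n ?g (\<lambda>i. int (parts ka i)) = 0" if ka: "ka \<in> partitions_of n" for ka
  proof -
    have "alt_coef n ?s (\<lambda>i. int (parts ka i)) =
        (\<Sum>la\<in>partitions_of n. if la = ka then ?c la else 0)"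
      unfolding alt_coef_sum
      by (intro sum.cong) (auto simp: alt_coef_schur_parts part ka)
    also have "\<dots> = ?c ka" using ka finite_partitions_of[of n] by simp
    finally show ?thesis by (simp add: alt_coef_minus)
  qed
  show ?thesis using symmetric_zero[OF 1 2 3, of a] by simp
qed

lemma schur_expansion_coefficient:
  assumes c: "is_schur_expansion f c" and ka: "is_partition ka" "length ka \<le> N"
    and N: "\<And>la. c la \<noteq> 0 \<Longrightarrow> length la \<le> N"
  shows "c ka = alt_coef N f (\<lambda>i. int (parts ka i))"
proof -
  let ?S = "{la. c la \<noteq> 0}"
  have fin: "finite ?S" and part: "\<And>la. c la \<noteq> 0 \<Longrightarrow> is_partition la"
    and f: "f = (\<lambda>a. \<Sum>la\<in>?S. c la * schur la a)"
    using c by (auto simp: is_schur_expansion_def)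
  have "alt_coef N f (\<lambda>i. int (parts ka i)) = (\<Sum>la\<in>?S. c la * alt_coef N (schur la) (\<lambda>i. int (parts ka i)))"
    by (subst f) (rule alt_coef_sum)
  also have "\<dots> = (\<Sum>la\<in>?S. if la = ka then c la else 0)"
    by (intro sum.cong) (auto simp: alt_coef_schur_parts part ka N)
  also have "\<dots> = c ka" using fin by simp
  finally show ?thesis ..
qed

text \<open>The two expansions may involve partitions of any sizes, so the number \<open>N\<close> of variables is chosen to
  exceed the lengths of all of them.\<close>
lemma schur_expansion_unique:
  assumes c: "is_schur_expansion f c" and d: "is_schur_expansion f d"
  shows "c = d"
proof
  fix ka
  have fin: "finite {la. c la \<noteq> 0}" "finite {la. d la \<noteq> 0}"
    and part: "c ka \<noteq> 0 \<or> d ka \<noteq> 0 \<Longrightarrow> is_partition ka"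
    using c d by (auto simp: is_schur_expansion_def)
  define N where "N = Max (length ` insert ka ({la. c la \<noteq> 0} \<union> {la. d la \<noteq> 0}))"
  have N: "length la \<le> N" if "la = ka \<or> c la \<noteq> 0 \<or> d la \<noteq> 0" for la
    unfolding N_def using that fin by (intro Max_ge) auto
  show "c ka = d ka"
  proof (cases "is_partition ka")
    case True
    then show ?thesis
      using schur_expansion_coefficient[OF c True, of N] schur_expansion_coefficient[OF d True, of N] N
      by simp
  next
    case False
    then show ?thesis using part by metis
  qed
qed

lemma LR_coeff_alt_coef:
  assumes mu: "mu \<in> partitions_of k" and nu: "nu \<in> partitions_of l" and la: "la \<in> partitions_of (k + l)"
  shows "LR_coeff la mu nu =
    alt_coef (k + l) (mseries_mult (schur mu) (schur nu)) (\<lambda>i. int (parts la i))"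
proof -
  let ?f = "mseries_mult (schur mu) (schur nu)"
  let ?P = "partitions_of (k + l)"
  define c where "c la = (if la \<in> ?P then alt_coef (k + l) ?f (\<lambda>i. int (parts la i)) else 0)" for la
  have part: "is_partition mu" "is_partition nu" "sum_list mu = k" "sum_list nu = l"
    using mu nu by (auto simp: partitions_of_def)
  have sym: "symmetric ?f" by (intro symmetric_mult_schur symmetric_schur part)
  have hom: "homogeneous (k + l) ?f"
    using homogeneous_mult homogeneous_schur part(3,4) by blast
  have sub: "{la. c la \<noteq> 0} \<subseteq> ?P" by (auto simp: c_def)
  have "?f a = (\<Sum>la | c la \<noteq> 0. c la * schur la a)" for a
  proof -
    have "?f a = (\<Sum>la\<in>?P. c la * schur la a)"
      unfolding c_def by (subst schur_expansion[OF sym hom]) simp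
    also have "\<dots> = (\<Sum>la | c la \<noteq> 0. c la * schur la a)"
      using sub finite_partitions_of by (intro sum.mono_neutral_right) auto
    finally show ?thesis .
  qed
  then have "is_schur_expansion ?f c"
    using sub finite_subset[OF sub finite_partitions_of]
    by (auto simp: is_schur_expansion_def partitions_of_def)
  then have "(THE c. is_schur_expansion ?f c) = c"
    using schur_expansion_unique by (intro the_equality) blast+
  then show ?thesis using la by (simp add: LR_coeff_def c_def)
qed

lemma LR_coeff_nonneg:
  assumes "mu \<in> partitions_of k" "nu \<in> partitions_of l" "la \<in> partitions_of (k + l)"
  shows "0 \<le> LR_coeff la mu nu"
  unfolding LR_coeff_alt_coef[OF assms]
proof (rule alt_coef_mult_schur_nonneg)
  show "length mu \<le> k + l" using length_partition_le[OF assms(1)] by simp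
  show "is_partition mu" "is_partition nu" using assms by (auto simp: partitions_of_def)
  have "is_partition la" using assms by (auto simp: partitions_of_def)
  note parts_dominant[OF this length_partition_le[OF assms(3)]]
  then show "decreasing (k + l) (\<lambda>i. int (parts la i))" "k + l \<le> i \<Longrightarrow> int (parts la i) = 0" for i
    by blast+
qed

lemma LR_expansion:
  assumes "mu \<in> partitions_of k" "nu \<in> partitions_of l"
  shows "mseries_mult (schur mu) (schur nu) a =
    (\<Sum>la\<in>partitions_of (k + l). LR_coeff la mu nu * schur la a)"
proof -
  have part: "is_partition mu" "is_partition nu" "sum_list mu = k" "sum_list nu = l"
    using assms by (auto simp: partitions_of_def)
  have "homogeneous (k + l) (mseries_mult (schur mu) (schur nu))"
    using homogeneous_mult homogeneous_schur part(3,4) by blast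
  then show ?thesis
    using schur_expansion[OF symmetric_mult_schur[OF symmetric_schur]] part
    by (simp add: LR_coeff_alt_coef[OF assms] cong: sum.cong)
qed

lemma schur_independent:
  assumes "\<And>a. (\<Sum>la\<in>partitions_of n. c la * schur la a) = (\<Sum>la\<in>partitions_of n. d la * schur la a)"
    and ka: "ka \<in> partitions_of n"
  shows "c ka = d ka"
proof -
  have part: "is_partition la" "length la \<le> n" if "la \<in> partitions_of n" for la
    using that length_partition_le by (auto simp: partitions_of_def)
  have "alt_coef n (\<lambda>a. \<Sum>la\<in>partitions_of n. c la * schur la a) (\<lambda>i. int (parts ka i)) = c ka" for c
  proof -
    have "alt_coef n (\<lambda>a. \<Sum>la\<in>partitions_of n. c la * schur la a) (\<lambda>i. int (parts ka i)) =
        (\<Sum>la\<in>partitions_of n. if la = ka then c la else 0)"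
      unfolding alt_coef_sum
      by (intro sum.cong) (auto simp: alt_coef_schur_parts part ka)
    also have "\<dots> = c ka" using ka finite_partitions_of[of n] by simp
    finally show ?thesis .
  qed
  from this[of c] this[of d] show ?thesis by (simp add: assms(1))
qed

section \<open>Powers of the first complete symmetric function\<close>

text \<open>The coefficients of \<open>(x\<^sub>0 + x\<^sub>1 + \<dots>)\<^sup>n\<close>, counting words by content.\<close>
definition h1_power :: "nat \<Rightarrow> mseries" where
  "h1_power n a = (if size a = n then int (card (permutations_of_multiset a)) else 0)"

lemma homogeneous_h1_power: "homogeneous n (h1_power n)"
  by (simp add: homogeneous_def h1_power_def)

lemma h1_power_0: "h1_power 0 = one"
  by (auto simp: h1_power_def one_def fun_eq_iff)

lemma symmetric_h1_power: "symmetric (h1_power n)"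
  unfolding symmetric_def
proof (intro allI)
  fix k and a :: "nat multiset"
  let ?t = "transpose k (Suc k)"
  have tt: "map ?t (map ?t w) = w" for w by (simp add: map_idI)
  have "card (permutations_of_multiset (image_mset ?t a)) = card (permutations_of_multiset a)"
  proof (rule bij_betw_same_card)
    show "bij_betw (map ?t) (permutations_of_multiset (image_mset ?t a)) (permutations_of_multiset a)"
      by (rule bij_betw_byWitness[where f' = "map ?t"])
         (auto simp: tt permutations_of_multiset_def multiset.map_comp comp_def)
  qed
  then show "h1_power n (image_mset ?t a) = h1_power n a" by (simp add: h1_power_def)
qed

text \<open>Cut a word of length \<open>k + l\<close> after its first \<open>k\<close> letters.\<close>
lemma h1_power_mult: "mseries_mult (h1_power k) (h1_power l) = h1_power (k + l)"
proof
  fix a :: "nat multiset"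
  show "mseries_mult (h1_power k) (h1_power l) a = h1_power (k + l) a"
  proof (cases "size a = k + l")
    case False
    then show ?thesis
      using homogeneous_mult[OF homogeneous_h1_power homogeneous_h1_power, of k l]
      by (auto simp: homogeneous_def h1_power_def)
  next
    case True
    let ?W = "permutations_of_multiset a"
    have len: "length w = k + l" if "w \<in> ?W" for w
      using that True by (auto simp: permutations_of_multiset_def)
    have split: "int (card {w \<in> ?W. mset (drop k w) = c}) = h1_power k (a - c) * h1_power l c"
      if c: "c \<subseteq># a" for c
    proof (cases "size c = l")
      case True
      have "size (a - c) = k" using True c \<open>size a = k + l\<close> by (simp add: size_Diff_submset)
      then have *: "size (a - c) = k" "size c = l" using True by simp_all
      have "bij_betw (\<lambda>w. (take k w, drop k w)) {w \<in> ?W. mset (drop k w) = c}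
              (permutations_of_multiset (a - c) \<times> permutations_of_multiset c)"
      proof (rule bij_betw_byWitness[where f' = "\<lambda>(u, v). u @ v"])
        have "mset (take k w) = mset w - mset (drop k w)" for w :: "nat list"
          by (metis add_diff_cancel_right' append_take_drop_id mset_append)
        then show "(\<lambda>w. (take k w, drop k w)) ` {w \<in> ?W. mset (drop k w) = c}
            \<subseteq> permutations_of_multiset (a - c) \<times> permutations_of_multiset c"
          by (auto simp: permutations_of_multiset_def)
        have "length u = k" if "u \<in> permutations_of_multiset (a - c)" for u
          using that * by (metis permutations_of_multisetD size_mset)
        then show "\<forall>p\<in>permutations_of_multiset (a - c) \<times> permutations_of_multiset c.
            (\<lambda>w. (take k w, drop k w)) (case p of (u, v) \<Rightarrow> u @ v) = p"
          "(\<lambda>(u, v). u @ v) ` (permutations_of_multiset (a - c) \<times> permutations_of_multiset c)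
            \<subseteq> {w \<in> ?W. mset (drop k w) = c}"
          using c by (auto simp: permutations_of_multiset_def)
      qed auto
      then show ?thesis
        by (simp add: bij_betw_same_card card_cartesian_product h1_power_def *)
    next
      case False
      have "mset (drop k w) \<noteq> c" if "w \<in> ?W" for w
        using False len[OF that] by auto
      then have "{w \<in> ?W. mset (drop k w) = c} = {}" by blast
      then show ?thesis using False by (simp add: h1_power_def)
    qed
    have "h1_power (k + l) a = (\<Sum>w\<in>?W. 1)" using True by (simp add: h1_power_def)
    also have "\<dots> = (\<Sum>c | c \<subseteq># a. \<Sum>w | w \<in> ?W \<and> mset (drop k w) = c. 1)"
    proof (rule sum.group[symmetric])
      have "mset (drop k w) \<subseteq># mset w" for w :: "nat list"
        by (metis append_take_drop_id mset_append mset_subset_eq_add_right)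
      then show "(\<lambda>w. mset (drop k w)) ` ?W \<subseteq> {c. c \<subseteq># a}"
        by (auto simp: permutations_of_multiset_def)
    qed (auto simp: finite_sub_mset)
    also have "\<dots> = (\<Sum>c | c \<subseteq># a. h1_power k (a - c) * h1_power l c)"
      using split by (intro sum.cong) simp_all
    also have "\<dots> = mseries_mult (h1_power k) (h1_power l) a" by (rule mseries_mult_sub[symmetric])
    finally show ?thesis ..
  qed
qed

lemma h1_power_Suc: "h1_power (Suc n) a = (\<Sum>i\<in>set_mset a. h1_power n (a - {#i#}))"
proof (cases "size a = Suc n")
  case False
  then show ?thesis by (intro sym[OF trans[OF sum.neutral]])
     (auto simp: h1_power_def size_Diff_singleton_if Suc_pred' dest!: multi_member_split)
next
  case True
  then have "a \<noteq> {#}" by auto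
  have "card (permutations_of_multiset a)
      = card (\<Union>i\<in>set_mset a. (#) i ` permutations_of_multiset (a - {#i#}))"
    by (simp add: permutations_of_multiset_nonempty[OF \<open>a \<noteq> {#}\<close>])
  also have "\<dots> = (\<Sum>i\<in>set_mset a. card ((#) i ` permutations_of_multiset (a - {#i#})))"
    by (rule card_UN_disjoint) auto
  also have "\<dots> = (\<Sum>i\<in>set_mset a. card (permutations_of_multiset (a - {#i#})))"
    by (intro sum.cong refl card_image) auto
  finally show ?thesis using True
    by (simp add: h1_power_def size_Diff_singleton)
qed

lemma coef_h1_power_Suc:
  assumes \<alpha>: "\<And>i. N \<le> i \<Longrightarrow> \<alpha> i = 0"
  shows "coef (h1_power (Suc n)) \<alpha> =
    (\<Sum>i<N. coef (h1_power n) (\<lambda>j. \<alpha> j - (if j = i then 1 else 0)))"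
proof (cases \<alpha> rule: exponent_cases)
  case (1 a)
  have a: "set_mset a \<subseteq> {..<N}"
  proof
    fix i assume "i \<in># a"
    then have "\<alpha> i \<noteq> 0" using 1 by simp
    then show "i \<in> {..<N}" using \<alpha> by (meson lessThan_iff not_le)
  qed
  have eq: "coef (h1_power n) (\<lambda>j. \<alpha> j - (if j = i then 1 else 0)) =
      (if i \<in># a then h1_power n (a - {#i#}) else 0)" for i
  proof -
    have "(\<lambda>j. \<alpha> j - (if j = i then 1 else 0)) = (\<lambda>j. int (count a j) - int (count {#i#} j))"
      by (simp add: 1 fun_eq_iff)
    then show ?thesis by (simp only: coef_diff_count single_subset_iff)
  qed
  have "coef (h1_power (Suc n)) \<alpha> = (\<Sum>i\<in>set_mset a. h1_power n (a - {#i#}))"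
    by (simp only: 1 coef_count h1_power_Suc)
  also have "\<dots> = (\<Sum>i<N. if i \<in># a then h1_power n (a - {#i#}) else 0)"
    using a by (intro sum.mono_neutral_cong_left) auto
  finally show ?thesis by (simp only: eq)
next
  case 2
  have "coef (h1_power n) (\<lambda>j. \<alpha> j - (if j = i then 1 else 0)) = 0" for i
  proof (rule ccontr)
    assume "coef (h1_power n) (\<lambda>j. \<alpha> j - (if j = i then 1 else 0)) \<noteq> 0"
    then obtain b where b: "(\<lambda>j. \<alpha> j - (if j = i then 1 else 0)) = (\<lambda>j. int (count b j))"
      by (cases "\<lambda>j. \<alpha> j - (if j = i then 1 else 0)" rule: exponent_cases) auto
    have "\<alpha> j = int (count (add_mset i b) j)" for j
      using fun_cong[OF b, of j] by (auto split: if_splits)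
    then have "\<alpha> = (\<lambda>j. int (count (add_mset i b) j))" by blast
    then have "coef (\<lambda>_. 1) \<alpha> = 1" by (simp only: coef_count)
    with 2 show False by simp
  qed
  with 2 show ?thesis by simp
qed

lemma alt_coef_h1_power_Suc:
  assumes lam: "\<And>i. N \<le> i \<Longrightarrow> lam i = 0"
  shows "alt_coef N (h1_power (Suc n)) lam =
    (\<Sum>i<N. alt_coef N (h1_power n) (\<lambda>j. lam j - (if j = i then 1 else 0)))"
proof -
  have "alt_coef N (h1_power (Suc n)) lam = (\<Sum>w | w permutes {..<N}.
      \<Sum>i<N. sign w * coef (h1_power n) (\<lambda>j. (lam j - (if j = i then 1 else 0)) - int j + int (w j)))"
    unfolding alt_coef_def
  proof (intro sum.cong refl)
    fix w assume "w \<in> {w. w permutes {..<N}}"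
    then have "lam i - int i + int (w i) = 0" if "N \<le> i" for i
      using that lam by (simp add: permutes_def)
    then have "coef (h1_power (Suc n)) (\<lambda>i. lam i - int i + int (w i)) =
        (\<Sum>i<N. coef (h1_power n) (\<lambda>j. (lam j - int j + int (w j)) - (if j = i then 1 else 0)))"
      by (rule coef_h1_power_Suc)
    also have "\<dots> = (\<Sum>i<N. coef (h1_power n) (\<lambda>j. (lam j - (if j = i then 1 else 0)) - int j + int (w j)))"
      by (simp add: algebra_simps)
    finally show "sign w * coef (h1_power (Suc n)) (\<lambda>i. lam i - int i + int (w i)) =
        (\<Sum>i<N. sign w * coef (h1_power n) (\<lambda>j. (lam j - (if j = i then 1 else 0)) - int j + int (w j)))"
      by (simp add: sum_distrib_left)
  qed
  also have "\<dots> = (\<Sum>i<N. alt_coef N (h1_power n) (\<lambda>j. lam j - (if j = i then 1 else 0)))"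
    unfolding alt_coef_def by (rule sum.swap)
  finally show ?thesis .
qed

section \<open>Standard tableaux\<close>

text \<open>Patterns of standard tableaux: at each of the \<open>n\<close> levels a single box is added.\<close>
definition standard_patterns :: "nat \<Rightarrow> (nat \<Rightarrow> nat) \<Rightarrow> (nat \<Rightarrow> nat \<Rightarrow> nat) set" where
  "standard_patterns n g = {H \<in> gt_patterns n g. \<forall>m<n. weight H m = 1}"

lemma finite_standard_patterns: "finite (standard_patterns n g)"
  unfolding standard_patterns_def using finite_gt by simp

lemma standard_patterns_0: "standard_patterns 0 g = (if g = (\<lambda>r. 0) then {\<lambda>m r. 0} else {})"
  by (auto simp: standard_patterns_def gt_patterns_def fun_eq_iff)

lemma nat_antimonoD:
  fixes g :: "nat \<Rightarrow> nat"
  assumes "\<And>r. g (Suc r) \<le> g r" "i \<le> j"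
  shows "g j \<le> g i"
  using assms(2) by (induction j rule: dec_induct) (auto intro: order_trans assms(1))

text \<open>Removing the box with the largest entry leaves a standard tableau whose shape has lost a corner box.
  On patterns this forgets the last level.\<close>
lemma card_standard_patterns_Suc:
  assumes anti: "\<And>r. g (Suc r) \<le> g r" and supp: "\<And>i. N \<le> i \<Longrightarrow> g i = 0"
  shows "card (standard_patterns (Suc n) g) =
    (\<Sum>i | i < N \<and> g (Suc i) < g i. card (standard_patterns n (g(i := g i - 1))))"
proof -
  let ?I = "{i. i < N \<and> g (Suc i) < g i}"
  let ?g = "\<lambda>i. g(i := g i - 1)"
  let ?S = "\<lambda>i. standard_patterns n (?g i)"
  define cut :: "(nat \<Rightarrow> nat \<Rightarrow> nat) \<Rightarrow> nat \<Rightarrow> nat \<Rightarrow> nat" where "cut H m = (if m \<le> n then H m else H n)" for H m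
  define ext :: "(nat \<Rightarrow> nat \<Rightarrow> nat) \<Rightarrow> nat \<Rightarrow> nat \<Rightarrow> nat" where "ext H m = (if m \<le> n then H m else g)" for H m
  have last: "\<exists>i\<in>?I. H n = ?g i" if H: "H \<in> standard_patterns (Suc n) g" for H
  proof -
    have G: "H \<in> gt_patterns (Suc n) g" and "weight H n = 1" using H by (auto simp: standard_patterns_def)
    have top: "H (Suc n) = g" using gtD(4)[OF G] by simp
    have le: "H n r \<le> g r" for r using gtD(3)[OF G, of n r] top by simp
    have "int (\<Sum>r\<le>n. g r - H n r) = 1"
      using \<open>weight H n = 1\<close> le by (simp add: weight_def top of_nat_diff)
    then have "(\<Sum>r\<le>n. g r - H n r) = 1" by linarith
    then have "\<exists>i\<in>{..n}. g i - H n i = 1 \<and> (\<forall>r\<in>{..n}. i \<noteq> r \<longrightarrow> g r - H n r = 0)"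
      by (subst (asm) sum_eq_1_iff) auto
    then obtain i where i: "i \<le> n" "g i - H n i = 1" "\<And>r. r \<le> n \<Longrightarrow> r \<noteq> i \<Longrightarrow> g r - H n r = 0"
      by (metis atMost_iff)
    have "H n r = ?g i r" for r
    proof (cases "r \<le> n")
      case True
      then show ?thesis using i le[of r] by (cases "r = i") force+
    next
      case False
      then show ?thesis using gt_zero[OF G, of n r] gt_zero[OF G, of "Suc n" r] top i(1) by auto
    qed
    then have eq: "H n = ?g i" by blast
    have "g (Suc i) \<le> H n i" using gtD(2)[OF G, of n i] top by simp
    then have "g (Suc i) < g i" using i(2) by linarith
    moreover from this have "i < N" using supp[of i] by (metis not_le not_less0)
    ultimately show ?thesis using eq by blast
  qed
  have "bij_betw cut (standard_patterns (Suc n) g) (\<Union>i\<in>?I. ?S i)"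
  proof (rule bij_betw_byWitness[where f' = ext])
    show "\<forall>H\<in>standard_patterns (Suc n) g. ext (cut H) = H"
      by (auto simp: ext_def cut_def fun_eq_iff standard_patterns_def gtD(4))
    show "\<forall>H\<in>\<Union>i\<in>?I. ?S i. cut (ext H) = H"
      by (auto simp: ext_def cut_def fun_eq_iff standard_patterns_def gtD(4))
    show "cut ` standard_patterns (Suc n) g \<subseteq> (\<Union>i\<in>?I. ?S i)"
    proof (intro image_subsetI)
      fix H assume H: "H \<in> standard_patterns (Suc n) g"
      then obtain i where i: "i \<in> ?I" "H n = ?g i" using last by blast
      have G: "H \<in> gt_patterns (Suc n) g" and w: "\<And>m. m \<le> n \<Longrightarrow> weight H m = 1"
        using H by (auto simp: standard_patterns_def)
      have anti': "H n (Suc r) \<le> H n r" for r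
        using gtD(2,3)[OF G] by (meson order_trans)
      have "cut H (Suc m) (Suc r) \<le> cut H m r \<and> cut H m r \<le> cut H (Suc m) r" for m r
        using gtD(2,3)[OF G, of m r] anti'[of r]
        by (cases "m < n"; cases "m = n"; simp add: cut_def)
      then have "cut H \<in> gt_patterns n (H n)"
        using gtD(1)[OF G] by (auto simp: gt_patterns_def cut_def)
      then have "cut H \<in> gt_patterns n (?g i)" by (simp only: i(2))
      moreover have "weight (cut H) m = 1" if "m < n" for m
        using that w[of m] by (simp add: weight_def cut_def)
      ultimately show "cut H \<in> (\<Union>i\<in>?I. ?S i)" using i(1) by (auto simp: standard_patterns_def)
    qed
    show "ext ` (\<Union>i\<in>?I. ?S i) \<subseteq> standard_patterns (Suc n) g"
    proof (intro image_subsetI)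
      fix H assume "H \<in> (\<Union>i\<in>?I. ?S i)"
      then obtain i where i: "g (Suc i) < g i" and G: "H \<in> gt_patterns n (?g i)" and w: "\<And>m. m < n \<Longrightarrow> weight H m = 1"
        by (auto simp: standard_patterns_def)
      have Hn: "H n = ?g i" using gtD(4)[OF G] by simp
      have "i \<le> n"
      proof (rule ccontr)
        assume "\<not> i \<le> n"
        then have "g n = 0" using gt_zero[OF G, of n n] Hn by auto
        then show False using nat_antimonoD[of g n i] anti i \<open>\<not> i \<le> n\<close> by simp
      qed
      have "g (Suc r) \<le> H n r \<and> H n r \<le> g r" for r
        using anti[of r] i by (auto simp: Hn)
      then have "ext H (Suc m) (Suc r) \<le> ext H m r \<and> ext H m r \<le> ext H (Suc m) r" for m r
        using gtD(2,3)[OF G, of m r] anti[of r]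
        by (cases "m < n"; cases "m = n"; simp add: ext_def)
      then have "ext H \<in> gt_patterns (Suc n) g"
        using gtD(1)[OF G] by (auto simp: gt_patterns_def ext_def)
      moreover have "weight (ext H) m = 1" if "m < Suc n" for m
      proof (cases "m = n")
        case True
        have "weight (ext H) n = (\<Sum>r\<le>n. if r = i then 1 else 0)"
          unfolding weight_def using i by (intro sum.cong) (auto simp: ext_def Hn)
        then show ?thesis using \<open>i \<le> n\<close> True by simp
      next
        case False
        then have "m < n" using that by simp
        then show ?thesis using w[of m] by (simp add: weight_def ext_def)
      qed
      ultimately show "ext H \<in> standard_patterns (Suc n) g" by (simp add: standard_patterns_def)
    qed
  qed
  then have "card (standard_patterns (Suc n) g) = card (\<Union>i\<in>?I. ?S i)"
    by (rule bij_betw_same_card)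
  also have "\<dots> = (\<Sum>i\<in>?I. card (?S i))"
  proof (rule card_UN_disjoint)
    show "\<forall>i\<in>?I. \<forall>j\<in>?I. i \<noteq> j \<longrightarrow> ?S i \<inter> ?S j = {}"
    proof (intro ballI impI)
      fix i j assume "i \<in> ?I" "j \<in> ?I" "i \<noteq> j"
      then have "?g i i \<noteq> ?g j i" by auto
      moreover have "H n = ?g i" if "H \<in> ?S i" for H i
        using that gtD(4)[of H n] by (auto simp: standard_patterns_def)
      ultimately show "?S i \<inter> ?S j = {}" by (metis disjoint_iff)
    qed
  qed (auto simp: finite_standard_patterns)
  finally show ?thesis .
qed

text \<open>Both sides satisfy the same recursion over the corners of \<open>g\<close>: subtracting a unit vector at a position
  that is not a corner leads to a wall or to a negative last entry, where \<open>alt_coef\<close> vanishes.\<close>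
lemma alt_coef_h1_power:
  assumes "\<And>r. g (Suc r) \<le> g r" "\<And>i. N \<le> i \<Longrightarrow> g i = 0"
  shows "alt_coef N (h1_power n) (\<lambda>i. int (g i)) = int (card (standard_patterns n g))"
  using assms
proof (induction n arbitrary: g)
  case 0
  have "alt_coef N one (\<lambda>i. int (g i)) = (if (\<lambda>i. int (g i)) = (\<lambda>i. 0) then 1 else 0)"
    using 0 by (intro alt_coef_one) (auto simp: decreasing_def)
  then show ?case by (simp add: h1_power_0 standard_patterns_0 fun_eq_iff)
next
  case (Suc n)
  let ?I = "{i. i < N \<and> g (Suc i) < g i}"
  let ?L = "\<lambda>i. alt_coef N (h1_power n) (\<lambda>j. int (g j) - (if j = i then 1 else 0))"
  have zero: "?L i = 0" if i: "i < N" "\<not> g (Suc i) < g i" for i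
  proof (cases "Suc i < N")
    case True
    have "g (Suc i) = g i" using i Suc.prems(1)[of i] by simp
    then show ?thesis using True
      by (intro alt_coef_wall[OF symmetric_h1_power]) auto
  next
    case False
    then have "i = N - 1" "g i = 0" using i Suc.prems(2)[of "Suc i"] Suc.prems(1)[of i] by auto
    then show ?thesis using i by (intro alt_coef_last_negative) auto
  qed
  have step: "?L i = int (card (standard_patterns n (g(i := g i - 1))))" if i: "i \<in> ?I" for i
  proof -
    have "(\<lambda>j. int (g j) - (if j = i then 1 else 0)) = (\<lambda>j. int ((g(i := g i - 1)) j))"
      using i by (auto simp: fun_eq_iff)
    moreover have "(g(i := g i - 1)) (Suc r) \<le> (g(i := g i - 1)) r" for r
      using i Suc.prems(1)[of r] by auto
    moreover have "(g(i := g i - 1)) r = 0" if "N \<le> r" for r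
      using i Suc.prems(2)[OF that] by auto
    ultimately show ?thesis using Suc.IH[of "g(i := g i - 1)"] by metis
  qed
  have "alt_coef N (h1_power (Suc n)) (\<lambda>i. int (g i)) = (\<Sum>i<N. ?L i)"
    using Suc.prems(2) by (intro alt_coef_h1_power_Suc) simp
  also have "\<dots> = (\<Sum>i\<in>?I. ?L i)"
    using zero by (intro sum.mono_neutral_right) auto
  also have "\<dots> = (\<Sum>i\<in>?I. int (card (standard_patterns n (g(i := g i - 1)))))"
    using step by (intro sum.cong) auto
  also have "\<dots> = int (card (standard_patterns (Suc n) g))"
    using card_standard_patterns_Suc[of g N n] Suc.prems by simp
  finally show ?case .
qed

text \<open>The last nonzero row always ends in a corner.\<close>
lemma standard_patterns_nonempty:
  assumes "\<And>r. g (Suc r) \<le> g r" "\<And>i. N \<le> i \<Longrightarrow> g i = 0" "(\<Sum>i<N. g i) = n"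
  shows "0 < card (standard_patterns n g)"
  using assms
proof (induction n arbitrary: g)
  case 0
  then have "g = (\<lambda>r. 0)" by (auto simp: fun_eq_iff) (meson lessThan_iff not_le)
  then show ?case by (simp add: standard_patterns_0)
next
  case (Suc n)
  have "\<exists>i<N. 0 < g i"
    using Suc.prems(3) by (metis gr0I lessThan_iff nat.distinct(1) sum.neutral)
  then obtain i where i: "i < N" "0 < g i" by blast
  define m where "m = (LEAST m. g (Suc m) = 0)"
  have ex: "g (Suc N) = 0" using Suc.prems(2) by simp
  have m0: "g (Suc m) = 0" unfolding m_def by (rule LeastI[of _ N]) (rule ex)
  have gm: "0 < g m"
  proof (cases m)
    case 0
    then show ?thesis using nat_antimonoD[of g 0 i] Suc.prems(1) i by auto
  next
    case (Suc k)
    then show ?thesis using not_less_Least[of k "\<lambda>m. g (Suc m) = 0"] by (auto simp: m_def)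
  qed
  have mN: "m < N" using gm Suc.prems(2) by (metis less_irrefl not_le)
  let ?g = "g(m := g m - 1)"
  have "(\<Sum>i<N. g i) = g m + (\<Sum>i\<in>{..<N} - {m}. g i)"
    using mN by (intro sum.remove) auto
  moreover have "(\<Sum>i<N. ?g i) = ?g m + (\<Sum>i\<in>{..<N} - {m}. ?g i)"
    using mN by (intro sum.remove) auto
  moreover have "(\<Sum>i\<in>{..<N} - {m}. ?g i) = (\<Sum>i\<in>{..<N} - {m}. g i)"
    by (intro sum.cong) auto
  ultimately have "(\<Sum>i<N. ?g i) = n" using Suc.prems(3) gm by simp
  moreover have "?g (Suc r) \<le> ?g r" for r using Suc.prems(1)[of r] m0 by auto
  moreover have "?g r = 0" if "N \<le> r" for r using Suc.prems(2)[OF that] mN that by auto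
  ultimately have pos: "0 < card (standard_patterns n ?g)" by (intro Suc.IH)
  have "card (standard_patterns n ?g) \<le>
      (\<Sum>i | i < N \<and> g (Suc i) < g i. card (standard_patterns n (g(i := g i - 1))))"
    using mN m0 gm by (intro member_le_sum[of m _ "\<lambda>i. card (standard_patterns n (g(i := g i - 1)))"]) auto
  then show ?case using pos card_standard_patterns_Suc[of g N n] Suc.prems by simp
qed

section \<open>Identities between numbers of standard tableaux\<close>

text \<open>The number \<open>f\<^sup>\<lambda>\<close> of standard tableaux, as the coefficient of a squarefree monomial.\<close>
definition num_standard :: "nat list \<Rightarrow> int" where
  "num_standard la = schur la (mset_set {..<sum_list la})"

lemma parts_bound:
  assumes "la \<in> partitions_of n"
  shows "parts la (Suc r) \<le> parts la r" "n \<le> i \<Longrightarrow> parts la i = 0"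
  using assms parts_antimono length_partition_le[OF assms]
  by (auto simp: partitions_of_def parts_def)

lemma num_standard_patterns:
  assumes la: "la \<in> partitions_of n"
  shows "num_standard la = int (card (standard_patterns n (parts la)))"
proof -
  have "H \<in> gt_patterns n (parts la) \<and> weight H = (\<lambda>m. int (count (mset_set {..<n}) m)) \<longleftrightarrow>
      H \<in> standard_patterns n (parts la)" for H
  proof -
    have "weight H = (\<lambda>m. int (count (mset_set {..<n}) m)) \<longleftrightarrow> (\<forall>m<n. weight H m = 1)"
      if "H \<in> gt_patterns n (parts la)"
      using weight_beyond[OF that] by (auto simp: fun_eq_iff count_mset_set')
    then show ?thesis by (auto simp: standard_patterns_def)
  qed
  then show ?thesis
    using schur_gt[of la "mset_set {..<n}" n] la
    by (simp add: num_standard_def partitions_of_def Collect_conj_eq cong: conj_cong)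
qed

lemma num_standard_pos:
  assumes la: "la \<in> partitions_of n"
  shows "0 < num_standard la"
proof -
  have "(\<Sum>i<length la. parts la i) = (\<Sum>i<n. parts la i)"
    using length_partition_le[OF la] by (intro sum.mono_neutral_left) (auto simp: parts_def)
  moreover have "(\<Sum>i<length la. parts la i) = sum_list la"
    by (simp add: parts_def sum_list_sum_nth atLeast0LessThan)
  ultimately have "(\<Sum>i<n. parts la i) = n" using la by (simp add: partitions_of_def)
  then show ?thesis
    using standard_patterns_nonempty[of "parts la" n n] parts_bound[OF la]
    by (simp add: num_standard_patterns[OF la])
qed

lemma h1_power_expansion:
  "h1_power n a = (\<Sum>la\<in>partitions_of n. num_standard la * schur la a)"
proof -
  have "alt_coef n (h1_power n) (\<lambda>i. int (parts la i)) = num_standard la"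
    if "la \<in> partitions_of n" for la
    using alt_coef_h1_power[of "parts la" n n] parts_bound[OF that] num_standard_patterns[OF that] by simp
  then show ?thesis
    by (subst schur_expansion[OF symmetric_h1_power homogeneous_h1_power]) (simp cong: sum.cong)
qed

text \<open>Compare the coefficients of \<open>x\<^sub>0 \<cdots> x\<^bsub>n-1\<^esub>\<close> in \<open>h\<^sub>1\<^sup>n = \<Sum>\<^sub>\<lambda> f\<^sup>\<lambda> s\<^sub>\<lambda>\<close>.\<close>
theorem sum_num_standard_squares:
  "(\<Sum>la\<in>partitions_of n. (num_standard la)\<^sup>2) = fact n"
proof -
  have "(\<Sum>la\<in>partitions_of n. (num_standard la)\<^sup>2) = h1_power n (mset_set {..<n})"
    unfolding h1_power_expansion
    by (intro sum.cong) (auto simp: power2_eq_square num_standard_def partitions_of_def)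
  also have "\<dots> = int (card (permutations_of_set {..<n}))"
    by (simp add: h1_power_def permutations_of_set_altdef)
  also have "\<dots> = fact n" by simp
  finally show ?thesis .
qed

text \<open>Expand both sides of \<open>h\<^sub>1\<^bsup>k + l\<^esup> = h\<^sub>1\<^sup>k h\<^sub>1\<^sup>l\<close> in Schur functions and compare coordinates. In
  terms of symmetric groups this is the dimension count for restriction to \<open>S\<^sub>k \<times> S\<^sub>l\<close>.\<close>
theorem num_standard_restriction:
  assumes la: "la \<in> partitions_of (k + l)"
  shows "num_standard la =
    (\<Sum>mu\<in>partitions_of k. \<Sum>nu\<in>partitions_of l. LR_coeff la mu nu * (num_standard mu * num_standard nu))"
proof -
  let ?P = "partitions_of (k + l)" and ?K = "partitions_of k" and ?L = "partitions_of l"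
  let ?f = num_standard
  have "(\<Sum>la\<in>?P. ?f la * schur la a) =
      (\<Sum>la\<in>?P. (\<Sum>mu\<in>?K. \<Sum>nu\<in>?L. LR_coeff la mu nu * (?f mu * ?f nu)) * schur la a)" for a
  proof -
    have "(\<Sum>la\<in>?P. ?f la * schur la a) = mseries_mult (h1_power k) (h1_power l) a"
      by (simp only: h1_power_mult h1_power_expansion)
    also have "\<dots> = (\<Sum>c | c \<subseteq># a. \<Sum>mu\<in>?K. \<Sum>nu\<in>?L.
        ?f mu * ?f nu * (schur mu (a - c) * schur nu c))"
      unfolding mseries_mult_sub h1_power_expansion sum_product
      by (intro sum.cong refl) (simp add: mult_ac)
    also have "\<dots> = (\<Sum>mu\<in>?K. \<Sum>nu\<in>?L. ?f mu * ?f nu * mseries_mult (schur mu) (schur nu) a)"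
      unfolding mseries_mult_sub sum_distrib_left
      by (subst sum.swap, intro sum.cong refl, rule sum.swap)
    also have "\<dots> = (\<Sum>mu\<in>?K. \<Sum>nu\<in>?L. \<Sum>la\<in>?P. LR_coeff la mu nu * (?f mu * ?f nu) * schur la a)"
      by (intro sum.cong refl) (simp add: LR_expansion sum_distrib_left mult_ac)
    also have "\<dots> = (\<Sum>mu\<in>?K. \<Sum>la\<in>?P. \<Sum>nu\<in>?L. LR_coeff la mu nu * (?f mu * ?f nu) * schur la a)"
      by (intro sum.cong refl sum.swap)
    also have "\<dots> = (\<Sum>la\<in>?P. \<Sum>mu\<in>?K. \<Sum>nu\<in>?L. LR_coeff la mu nu * (?f mu * ?f nu) * schur la a)"
      by (rule sum.swap)
    finally show ?thesis by (simp add: sum_distrib_right)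
  qed
  from schur_independent[OF this la] show ?thesis .
qed

text \<open>Gaps in the index set are closed by adjacent transpositions, each of which lowers the index sum.\<close>
lemma symmetric_squarefree:
  assumes f: "symmetric f" and B: "finite B"
  shows "f (mset_set B) = f (mset_set {..<card B})"
  using B
proof (induction "\<Sum>B" arbitrary: B rule: less_induct)
  case less
  show ?case
  proof (cases "\<exists>x. Suc x \<in> B \<and> x \<notin> B")
    case True
    then obtain x where x: "Suc x \<in> B" "x \<notin> B" by blast
    let ?t = "transpose x (Suc x)"
    have inj: "inj_on ?t B" by simp
    have B': "?t ` B = insert x (B - {Suc x})"
      using x by (auto simp: transpose_def image_iff split: if_splits)
    have "\<Sum>B = Suc x + \<Sum>(B - {Suc x})" using x less.prems by (simp add: sum.remove)
    then have "\<Sum>(?t ` B) < \<Sum>B" unfolding B' using x less.prems by simp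
    then have "f (mset_set (?t ` B)) = f (mset_set {..<card (?t ` B)})"
      using less by blast
    moreover have "mset_set (?t ` B) = image_mset ?t (mset_set B)"
      by (rule image_mset_mset_set[OF inj, symmetric])
    ultimately show ?thesis using f by (simp add: symmetric_def card_image[OF inj])
  next
    case False
    have down: "x \<in> B" if "y \<in> B" "x \<le> y" for x y
      using that(2,1) by (induction y rule: dec_induct) (use False in blast)+
    have "B = {..<card B}"
    proof (rule card_subset_eq[symmetric])
      show "finite B" by (rule less.prems)
      show "{..<card B} \<subseteq> B"
      proof
        fix x assume "x \<in> {..<card B}"
        then have "\<not> B \<subseteq> {..<x}" using card_mono[of "{..<x}" B] by auto
        then show "x \<in> B" using down by (meson lessThan_iff not_le subsetI)
      qed
    qed simp
    then show ?thesis by metis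
  qed
qed

text \<open>Compare the coefficients of \<open>x\<^sub>0 \<cdots> x\<^bsub>k + l - 1\<^esub>\<close> in \<open>s\<^sub>\<mu> s\<^sub>\<nu>\<close>: the variables are distributed over the
  two factors in \<open>(k + l) choose k\<close> ways.\<close>
theorem num_standard_induction:
  assumes mu: "mu \<in> partitions_of k" and nu: "nu \<in> partitions_of l"
  shows "(\<Sum>la\<in>partitions_of (k + l). LR_coeff la mu nu * num_standard la) =
    int ((k + l) choose k) * (num_standard mu * num_standard nu)"
proof -
  define X where "X = {..<k + l}"
  have fin: "finite X" and card: "card X = k + l" by (simp_all add: X_def)
  have sums: "sum_list mu = k" "sum_list nu = l" and part: "is_partition mu" "is_partition nu"
    using assms by (auto simp: partitions_of_def)
  have val: "schur la (mset_set B) = (if card B = sum_list la then num_standard la else 0)"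
    if "is_partition la" "finite B" for la B
    using symmetric_squarefree[OF symmetric_schur[OF that(1)] that(2)] homogeneous_schur[of la]
    by (auto simp: num_standard_def homogeneous_def)
  have "(\<Sum>la\<in>partitions_of (k + l). LR_coeff la mu nu * num_standard la) =
      mseries_mult (schur mu) (schur nu) (mset_set X)"
    unfolding LR_expansion[OF assms]
    by (intro sum.cong) (auto simp: num_standard_def partitions_of_def X_def)
  also have "\<dots> = (\<Sum>B\<in>Pow X. schur mu (mset_set B) * schur nu (mset_set (X - B)))"
    unfolding mseries_mult_def
  proof (rule sum.reindex_bij_witness[where j = "\<lambda>(b, c). set_mset b"
        and i = "\<lambda>B. (mset_set B, mset_set (X - B))"])
    fix p assume "p \<in> {(b, c). b + c = mset_set X}"
    then obtain b c where p: "p = (b, c)" "b + c = mset_set X" by auto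
    have cnt: "count b x + count c x = (if x \<in> X then 1 else 0)" for x
      using arg_cong[OF p(2), of "\<lambda>m. count m x"] fin by (simp add: count_mset_set')
    have b: "mset_set (set_mset b) = b"
    proof (rule multiset_eqI)
      fix x show "count (mset_set (set_mset b)) x = count b x"
        using cnt[of x] count_greater_zero_iff[of b x]
        by (auto simp: count_mset_set' simp del: count_greater_zero_iff split: if_splits)
    qed
    have c: "mset_set (X - set_mset b) = c"
    proof (rule multiset_eqI)
      fix x show "count (mset_set (X - set_mset b)) x = count c x"
        using cnt[of x] fin count_greater_zero_iff[of b x]
        by (auto simp: count_mset_set' simp del: count_greater_zero_iff split: if_splits)
    qed
    show "(mset_set (case p of (b, c) \<Rightarrow> set_mset b), mset_set (X - (case p of (b, c) \<Rightarrow> set_mset b))) = p"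
      using p b c by simp
    have "set_mset b \<subseteq> X" using cnt by (metis add_is_0 count_eq_zero_iff subsetI)
    then show "(case p of (b, c) \<Rightarrow> set_mset b) \<in> Pow X" using p by simp
    show "schur mu (mset_set (case p of (b, c) \<Rightarrow> set_mset b)) *
        schur nu (mset_set (X - (case p of (b, c) \<Rightarrow> set_mset b))) =
        (case p of (b, c) \<Rightarrow> schur mu b * schur nu c)"
      using p b c by simp
  next
    fix B assume "B \<in> Pow X"
    then have B: "B \<subseteq> X" "finite B" using fin finite_subset by auto
    show "(case (mset_set B, mset_set (X - B)) of (b, c) \<Rightarrow> set_mset b) = B" using B by simp
    have "mset_set B + mset_set (X - B) = mset_set X"
      using B fin by (metis Diff_disjoint Un_Diff_cancel finite_Diff mset_set_Union sup.absorb_iff2)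
    then show "(mset_set B, mset_set (X - B)) \<in> {(b, c). b + c = mset_set X}" by simp
  qed
  also have "\<dots> = (\<Sum>B\<in>Pow X. if card B = k then num_standard mu * num_standard nu else 0)"
  proof (intro sum.cong refl)
    fix B assume "B \<in> Pow X"
    then have B: "B \<subseteq> X" "finite B" "finite (X - B)" using fin finite_subset by auto
    then have "card B + card (X - B) = k + l"
      using card card_Diff_subset[OF B(2,1)] card_mono[OF fin B(1)] by simp
    then show "schur mu (mset_set B) * schur nu (mset_set (X - B)) =
        (if card B = k then num_standard mu * num_standard nu else 0)"
      using val[OF part(1) B(2)] val[OF part(2) B(3)] sums by auto
  qed
  also have "\<dots> = (\<Sum>B | B \<in> Pow X \<and> card B = k. num_standard mu * num_standard nu)"
    by (rule sum.inter_filter[symmetric]) (simp add: fin)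
  also have "\<dots> = int (card {B. B \<subseteq> X \<and> card B = k}) * (num_standard mu * num_standard nu)"
    by simp
  also have "card {B. B \<subseteq> X \<and> card B = k} = (k + l) choose k"
    using n_subsets[OF fin, of k] card by simp
  finally show ?thesis .
qed

section \<open>The number of partitions\<close>

definition bounded_partitions :: "nat \<Rightarrow> nat \<Rightarrow> nat list set" where
  "bounded_partitions m n = {la \<in> partitions_of n. set la \<subseteq> {..m}}"

lemma finite_bounded_partitions: "finite (bounded_partitions m n)"
  using finite_partitions_of by (simp add: bounded_partitions_def)

lemma bounded_partitions_0: "card (bounded_partitions 0 n) \<le> (if n = 0 then 1 else 0)"
proof -
  have "la = []" if "is_partition la" "set la \<subseteq> {..0}" for la :: "nat list"
    using that by (cases la) (auto simp: is_partition_def)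
  then have "bounded_partitions 0 n \<subseteq> (if n = 0 then {[]} else {})"
    by (fastforce simp: bounded_partitions_def partitions_of_def)
  from card_mono[OF _ this] show ?thesis by (auto split: if_splits)
qed

text \<open>Either the part \<open>m + 1\<close> does not occur, or it is the first part and can be removed.\<close>
lemma bounded_partitions_Suc:
  "card (bounded_partitions (Suc m) n) \<le> card (bounded_partitions m n) +
    (if Suc m \<le> n then card (bounded_partitions (Suc m) (n - Suc m)) else 0)"
proof -
  let ?B = "if Suc m \<le> n then (#) (Suc m) ` bounded_partitions (Suc m) (n - Suc m) else {}"
  have "bounded_partitions (Suc m) n \<subseteq> bounded_partitions m n \<union> ?B"
  proof
    fix la assume la: "la \<in> bounded_partitions (Suc m) n"
    show "la \<in> bounded_partitions m n \<union> ?B"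
    proof (cases "Suc m \<in> set la")
      case False
      then have "set la \<subseteq> {..m}" using la le_Suc_eq by (auto simp: bounded_partitions_def)
      then show ?thesis using la by (simp add: bounded_partitions_def)
    next
      case True
      then obtain x xs where xs: "la = x # xs" by (cases la) auto
      then have "x = Suc m" using la True
        by (auto simp: bounded_partitions_def partitions_of_def is_partition_def intro: le_antisym)
      moreover from this have "Suc m \<le> n" "xs \<in> bounded_partitions (Suc m) (n - Suc m)"
        using la xs by (auto simp: bounded_partitions_def partitions_of_def is_partition_def)
      ultimately show ?thesis using xs by auto
    qed
  qed
  then have "card (bounded_partitions (Suc m) n) \<le> card (bounded_partitions m n \<union> ?B)"
    using finite_bounded_partitions by (intro card_mono) auto
  also have "\<dots> \<le> card (bounded_partitions m n) + card ?B" by (rule card_Un_le)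
  also have "card ?B = (if Suc m \<le> n then card (bounded_partitions (Suc m) (n - Suc m)) else 0)"
    by (simp add: card_image)
  finally show ?thesis by simp
qed

text \<open>One coefficient of Euler's product is bounded by the value of the product; the recursion proves this
  without infinite series.\<close>
lemma bounded_partitions_generating_function:
  fixes x :: real
  assumes "0 < x" "x < 1"
  shows "real (card (bounded_partitions m n)) * x ^ n \<le> (\<Prod>i=1..m. 1 / (1 - x ^ i))"
proof (induction m arbitrary: n)
  case 0
  have "real (card (bounded_partitions 0 n)) * x ^ n \<le> real (if n = 0 then 1 else 0) * x ^ n"
    using bounded_partitions_0[of n] assms by (intro mult_right_mono of_nat_mono) auto
  also have "\<dots> \<le> 1" by simp
  finally show ?case by simp
next
  case (Suc m)
  let ?A = "\<Prod>i=1..m. 1 / (1 - x ^ i)"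
  have lt: "x ^ Suc m < 1" using assms by (intro power_Suc_less_one) auto
  have geometric: "A + q * (A / (1 - q)) = A / (1 - q)" if "q < 1" for A q :: real
    using that by (simp add: field_simps)
  have A: "0 \<le> ?A" using assms by (intro prod_nonneg) (auto simp: power_le_one)
  show ?case
  proof (induction n rule: less_induct)
    case (less n)
    let ?c = "\<lambda>n. real (card (bounded_partitions (Suc m) n)) * x ^ n"
    have "?c n \<le> real (card (bounded_partitions m n) +
        (if Suc m \<le> n then card (bounded_partitions (Suc m) (n - Suc m)) else 0)) * x ^ n"
      using assms bounded_partitions_Suc by (intro mult_right_mono of_nat_mono) auto
    also have "\<dots> = real (card (bounded_partitions m n)) * x ^ n +
        (if Suc m \<le> n then x ^ Suc m * ?c (n - Suc m) else 0)"
      by (auto simp: algebra_simps simp flip: power_add power_Suc)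
    also have "\<dots> \<le> ?A + x ^ Suc m * (?A / (1 - x ^ Suc m))"
    proof (rule add_mono)
      show "real (card (bounded_partitions m n)) * x ^ n \<le> ?A" by (rule Suc.IH)
      show "(if Suc m \<le> n then x ^ Suc m * ?c (n - Suc m) else 0) \<le> x ^ Suc m * (?A / (1 - x ^ Suc m))"
      proof (cases "Suc m \<le> n")
        case True
        then have "?c (n - Suc m) \<le> ?A / (1 - x ^ Suc m)"
          using less[of "n - Suc m"] by simp
        then have "x ^ Suc m * ?c (n - Suc m) \<le> x ^ Suc m * (?A / (1 - x ^ Suc m))"
          using assms by (intro mult_left_mono) auto
        then show ?thesis using True by (simp only: if_True)
      next
        case False
        have "0 \<le> x ^ Suc m * (?A / (1 - x ^ Suc m))"
          using A lt assms by (intro mult_nonneg_nonneg divide_nonneg_nonneg) auto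
        then show ?thesis using False by (simp only: if_False)
      qed
    qed
    also have "\<dots> = ?A / (1 - x ^ Suc m)"
      by (rule geometric[OF lt])
    also have "\<dots> = (\<Prod>i=1..Suc m. 1 / (1 - x ^ i))" by simp
    finally show ?case .
  qed
qed

text \<open>For \<open>m = s\<close>, the bound for the factors of small index in the partition product.\<close>
lemma prod_one_plus_ratio: "(\<Prod>i=1..m. 1 + real s / real i) = real ((s + m) choose m)"
proof (induction m)
  case (Suc m)
  have "Suc m * ((s + Suc m) choose Suc m) = Suc (s + m) * ((s + m) choose m)"
    using Suc_times_binomial[of m "s + m"] by (simp only: add_Suc_right)
  then have "real (Suc m) * real ((s + Suc m) choose Suc m) = real (Suc (s + m)) * real ((s + m) choose m)"
    by (simp only: of_nat_mult[symmetric])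
  then have "real ((s + Suc m) choose Suc m) = (1 + real s / real (Suc m)) * real ((s + m) choose m)"
    by (simp add: field_simps)
  moreover have "(\<Prod>i=1..Suc m. 1 + real s / real i) =
      (\<Prod>i=1..m. 1 + real s / real i) * (1 + real s / real (Suc m))" by simp
  ultimately show ?case by (simp only: Suc.IH mult.commute)
qed simp

text \<open>Evaluate the product at \<open>x = s/(s + 1)\<close>, so that \<open>x\<^sup>i \<le> s/(s + i)\<close> by Bernoulli and
  \<open>\<Sum>\<^sub>i x\<^sup>i \<le> s + 1\<close>. The factors with \<open>i \<le> s\<close> are at most \<open>1 + s/i\<close> and multiply to a binomial
  coefficient below \<open>4\<^sup>s\<close>; those with \<open>i > s\<close> have \<open>x\<^sup>i \<le> 1/2\<close> and are at most \<open>e\<^bsup>2x^i\<^esup>\<close>; and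
  \<open>x\<^bsup>-n\<^esup> \<le> e\<^bsup>n/s\<^esup>\<close>.\<close>
lemma card_partitions_le_exp:
  assumes s: "1 \<le> s" and n: "n \<le> s * s"
  shows "real (card (partitions_of n)) \<le> exp (7 * real s)"
proof -
  define x where "x = real s / (real s + 1)"
  have x: "0 < x" "x < 1" using s by (auto simp: x_def)
  have pow: "x ^ i \<le> real s / (real s + real i)" for i
  proof -
    have "1 + real i * (1 / real s) \<le> (1 + 1 / real s) ^ i"
      by (rule Bernoulli_inequality) (rule order_trans[where y = 0], simp_all)
    moreover have "x = 1 / (1 + 1 / real s)" using s by (simp add: x_def field_simps)
    moreover have "0 < 1 + real i * (1 / real s)" by (intro add_pos_nonneg) simp_all
    ultimately have "x ^ i \<le> 1 / (1 + real i * (1 / real s))"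
      by (simp only: power_one_over) (rule divide_left_mono, simp_all)
    also have "\<dots> = real s / (real s + real i)" using s by (simp add: field_simps)
    finally show ?thesis .
  qed
  have pos: "x ^ i < 1" if "1 \<le> i" for i using x that by (simp add: power_less_one_iff)
  \<comment> \<open>Parts up to \<open>s + n\<close> are allowed so that the product always splits at \<open>s\<close>.\<close>
  have "bounded_partitions (s + n) n = partitions_of n"
    using member_le_sum_list by (fastforce simp: bounded_partitions_def partitions_of_def)
  then have "real (card (partitions_of n)) * x ^ n \<le> (\<Prod>i=1..s + n. 1 / (1 - x ^ i))"
    using bounded_partitions_generating_function[OF x, of "s + n" n] by simp
  also have "\<dots> = (\<Prod>i=1..s. 1 / (1 - x ^ i)) * (\<Prod>i=s + 1..s + n. 1 / (1 - x ^ i))"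
    by (rule prod.ub_add_nat) simp
  also have "\<dots> \<le> exp (2 * real s) * exp (4 * real s)"
  proof (rule mult_mono)
    have "(\<Prod>i=1..s. 1 / (1 - x ^ i)) \<le> (\<Prod>i=1..s. 1 + real s / real i)"
    proof (rule prod_mono)
      fix i assume i: "i \<in> {1..s}"
      have "1 / (1 - x ^ i) \<le> 1 / (1 - real s / (real s + real i))"
        using i s pow[of i] by (intro divide_left_mono) (auto simp: field_simps pos)
      also have "\<dots> = 1 + real s / real i" using i by (simp add: field_simps)
      finally show "0 \<le> 1 / (1 - x ^ i) \<and> 1 / (1 - x ^ i) \<le> 1 + real s / real i"
        using pos[of i] i by simp
    qed
    also have "\<dots> = real ((s + s) choose s)" by (rule prod_one_plus_ratio)
    also have "\<dots> \<le> 2 ^ (s + s)"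
      using binomial_le_pow2[of "s + s" s] by (metis of_nat_le_iff of_nat_numeral of_nat_power)
    also have "\<dots> \<le> exp 1 ^ (s + s)"
      using exp_ge_add_one_self[of 1] by (intro power_mono) auto
    also have "\<dots> = exp (2 * real s)" by (simp flip: exp_of_nat_mult)
    finally show "(\<Prod>i=1..s. 1 / (1 - x ^ i)) \<le> exp (2 * real s)" .
  next
    have "(\<Prod>i=s + 1..s + n. 1 / (1 - x ^ i)) \<le> (\<Prod>i=s + 1..s + n. exp (2 * x ^ i))"
    proof (rule prod_mono)
      fix i assume i: "i \<in> {s + 1..s + n}"
      then have "real s / (real s + real i) \<le> 1 / 2" by (simp add: field_simps)
      then have half: "x ^ i \<le> 1 / 2" using pow[of i] by linarith
      have "0 \<le> x ^ i * (1 - 2 * x ^ i)" using half x by (intro mult_nonneg_nonneg) auto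
      then have "1 \<le> (1 + 2 * x ^ i) * (1 - x ^ i)" by (simp add: algebra_simps)
      then have "1 / (1 - x ^ i) \<le> 1 + 2 * x ^ i" using half by (simp add: divide_le_eq)
      also have "\<dots> \<le> exp (2 * x ^ i)" by (rule exp_ge_add_one_self)
      finally show "0 \<le> 1 / (1 - x ^ i) \<and> 1 / (1 - x ^ i) \<le> exp (2 * x ^ i)"
        using half by simp
    qed
    also have "\<dots> = exp (2 * (\<Sum>i=s + 1..s + n. x ^ i))"
      by (simp add: exp_sum sum_distrib_left)
    also have "(\<Sum>i=s + 1..s + n. x ^ i) \<le> (\<Sum>i<Suc (s + n). x ^ i)"
      using x by (intro sum_mono2) auto
    also have "\<dots> = (1 - x ^ Suc (s + n)) / (1 - x)"
      using x by (subst sum_gp_strict) simp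
    also have "\<dots> \<le> 1 / (1 - x)" using x by (intro divide_right_mono) auto
    also have "\<dots> = real s + 1" using s by (simp add: x_def field_simps)
    also have "\<dots> \<le> 2 * real s" using s by simp
    finally show "(\<Prod>i=s + 1..s + n. 1 / (1 - x ^ i)) \<le> exp (4 * real s)" by simp
  next
    show "0 \<le> (\<Prod>i=s + 1..s + n. 1 / (1 - x ^ i))"
      using pos by (intro prod_nonneg) (auto simp: less_imp_le)
  qed simp
  also have "\<dots> = exp (6 * real s)" by (simp flip: exp_add)
  finally have main: "real (card (partitions_of n)) * x ^ n \<le> exp (6 * real s)" .
  have "1 + 1 / real s = (real s + 1) / real s" using s by (simp add: field_simps)
  then have "x * (1 + 1 / real s) = 1" using s by (simp add: x_def)
  then have "1 = x ^ n * (1 + 1 / real s) ^ n" by (simp flip: power_mult_distrib)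
  also have "\<dots> \<le> x ^ n * exp (real s)"
  proof (rule mult_left_mono)
    have "(1 + 1 / real s) ^ n \<le> exp (1 / real s) ^ n" by (intro power_mono) auto
    also have "\<dots> = exp (real n / real s)" by (simp flip: exp_of_nat_mult)
    also have "\<dots> \<le> exp (real s)"
      using s of_nat_mono[OF n, where 'a = real] by (simp add: divide_le_eq)
    finally show "(1 + 1 / real s) ^ n \<le> exp (real s)" .
  qed (use x in simp)
  finally have "real (card (partitions_of n)) * 1 \<le> real (card (partitions_of n)) * (x ^ n * exp (real s))"
    by (rule mult_left_mono) simp
  also have "\<dots> = real (card (partitions_of n)) * x ^ n * exp (real s)" by simp
  also have "\<dots> \<le> exp (6 * real s) * exp (real s)" using main by (rule mult_right_mono) simp
  also have "\<dots> = exp (7 * real s)" by (simp flip: exp_add)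
  finally show ?thesis by simp
qed

text \<open>Take \<open>s\<close> to be the square root of \<open>n\<close>, rounded up.\<close>
theorem card_partitions_le_exp_sqrt:
  assumes n: "1 \<le> n"
  shows "real (card (partitions_of n)) \<le> exp (14 * sqrt (real n))"
proof -
  define s where "s = nat \<lceil>sqrt (real n)\<rceil>"
  have r: "1 \<le> sqrt (real n)" using n by simp
  then have s: "sqrt (real n) \<le> real s" "real s \<le> sqrt (real n) + 1"
    by (simp_all add: s_def)
  have "real n = sqrt (real n) * sqrt (real n)" by simp
  also have "\<dots> \<le> real s * real s" using s(1) r by (intro mult_mono) auto
  finally have "n \<le> s * s" by (simp flip: of_nat_mult)
  moreover have "1 \<le> real s" using s(1) r by linarith
  then have "1 \<le> s" by simp
  ultimately have "real (card (partitions_of n)) \<le> exp (7 * real s)"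
    by (intro card_partitions_le_exp)
  also have "7 * real s \<le> 14 * sqrt (real n)" using s(2) r by linarith
  finally show ?thesis by simp
qed

section \<open>The largest Littlewood-Richardson coefficient\<close>

lemma LR_max_attained:
  obtains la mu nu where "la \<in> partitions_of n" "mu \<in> partitions_of k" "nu \<in> partitions_of (n - k)"
    "LR_max n k = LR_coeff la mu nu"
proof -
  note M = Max_in[OF finite_imageI[OF finite_partitions_of]]
  have "LR_max n k \<in> (\<lambda>la. MAX mu \<in> partitions_of k. MAX nu \<in> partitions_of (n - k). LR_coeff la mu nu) `
      partitions_of n"
    unfolding LR_max_def by (rule M) (simp add: partitions_of_nonempty)
  then obtain la where la: "la \<in> partitions_of n"
    "LR_max n k = (MAX mu \<in> partitions_of k. MAX nu \<in> partitions_of (n - k). LR_coeff la mu nu)" by blast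
  have "LR_max n k \<in> (\<lambda>mu. MAX nu \<in> partitions_of (n - k). LR_coeff la mu nu) ` partitions_of k"
    unfolding la(2) by (rule M) (simp add: partitions_of_nonempty)
  then obtain mu where mu: "mu \<in> partitions_of k"
    "LR_max n k = (MAX nu \<in> partitions_of (n - k). LR_coeff la mu nu)" by blast
  have "LR_max n k \<in> (\<lambda>nu. LR_coeff la mu nu) ` partitions_of (n - k)"
    unfolding mu(2) by (rule M) (simp add: partitions_of_nonempty)
  with la(1) mu(1) that show ?thesis by blast
qed

lemma LR_coeff_le_max:
  assumes "la \<in> partitions_of n" "mu \<in> partitions_of k" "nu \<in> partitions_of (n - k)"
  shows "LR_coeff la mu nu \<le> LR_max n k"
proof -
  have "LR_coeff la mu nu \<le> (MAX nu \<in> partitions_of (n - k). LR_coeff la mu nu)"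
    by (intro Max_ge finite_imageI finite_partitions_of imageI assms(3))
  also have "\<dots> \<le> (MAX mu \<in> partitions_of k. MAX nu \<in> partitions_of (n - k). LR_coeff la mu nu)"
    by (intro Max_ge finite_imageI finite_partitions_of imageI assms(2))
  also have "\<dots> \<le> LR_max n k" unfolding LR_max_def
    by (intro Max_ge finite_imageI finite_partitions_of imageI assms(1))
  finally show ?thesis .
qed

text \<open>As all coefficients are nonnegative, a single term is at most the sum in the two identities, which
  gives \<open>c f\<^sup>\<lambda> \<le> (n choose k) f\<^sup>\<mu> f\<^sup>\<nu>\<close> and \<open>c f\<^sup>\<mu> f\<^sup>\<nu> \<le> f\<^sup>\<lambda>\<close>. Multiply.\<close>
lemma LR_coeff_square_le:
  assumes la: "la \<in> partitions_of (k + l)" and mu: "mu \<in> partitions_of k" and nu: "nu \<in> partitions_of l"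
  shows "(LR_coeff la mu nu)\<^sup>2 \<le> int ((k + l) choose k)"
proof -
  let ?c = "LR_coeff la mu nu" and ?f = num_standard
  have pos: "0 < ?f la" "0 < ?f mu" "0 < ?f nu" using assms num_standard_pos by blast+
  have c0: "0 \<le> ?c" by (rule LR_coeff_nonneg[OF mu nu la])
  have "?c * ?f la \<le> (\<Sum>la\<in>partitions_of (k + l). LR_coeff la mu nu * ?f la)"
    using la mu nu finite_partitions_of
    by (intro member_le_sum[of la _ "\<lambda>la. LR_coeff la mu nu * ?f la"] mult_nonneg_nonneg)
       (auto intro: LR_coeff_nonneg less_imp_le num_standard_pos)
  then have 1: "?c * ?f la \<le> int ((k + l) choose k) * (?f mu * ?f nu)"
    by (simp only: num_standard_induction[OF mu nu])
  have term0: "0 \<le> LR_coeff la mu' nu' * (?f mu' * ?f nu')"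
    if "mu' \<in> partitions_of k" "nu' \<in> partitions_of l" for mu' nu'
    using LR_coeff_nonneg[OF that la] num_standard_pos that
    by (intro mult_nonneg_nonneg) (auto intro: less_imp_le)
  have "?c * (?f mu * ?f nu) \<le> (\<Sum>nu\<in>partitions_of l. LR_coeff la mu nu * (?f mu * ?f nu))"
    using nu mu term0 finite_partitions_of
    by (intro member_le_sum[of nu _ "\<lambda>nu. LR_coeff la mu nu * (?f mu * ?f nu)"]) auto
  also have "\<dots> \<le> ?f la"
    unfolding num_standard_restriction[OF la]
    using mu term0 finite_partitions_of
    by (intro member_le_sum[of mu _ "\<lambda>mu. \<Sum>nu\<in>partitions_of l. LR_coeff la mu nu * (?f mu * ?f nu)"] sum_nonneg) auto
  finally have 2: "?c * (?f mu * ?f nu) \<le> ?f la" .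
  have "?c\<^sup>2 * (?f la * (?f mu * ?f nu)) = (?c * ?f la) * (?c * (?f mu * ?f nu))"
    by (simp add: power2_eq_square)
  also have "\<dots> \<le> (int ((k + l) choose k) * (?f mu * ?f nu)) * ?f la"
    by (rule mult_mono[OF 1 2]) (use pos c0 in auto)
  also have "\<dots> = int ((k + l) choose k) * (?f la * (?f mu * ?f nu))" by simp
  finally show ?thesis using pos by simp
qed

lemma num_standard_le_sqrt:
  assumes "la \<in> partitions_of n"
  shows "real_of_int (num_standard la) \<le> sqrt (fact n)"
proof -
  have "(num_standard la)\<^sup>2 \<le> (\<Sum>la\<in>partitions_of n. (num_standard la)\<^sup>2)"
    using assms finite_partitions_of by (intro member_le_sum) auto
  then have "(num_standard la)\<^sup>2 \<le> fact n" by (simp only: sum_num_standard_squares)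
  then have "real_of_int ((num_standard la)\<^sup>2) \<le> real_of_int (fact n)" by (simp only: of_int_le_iff)
  then show ?thesis by (intro real_le_rsqrt) simp
qed

text \<open>The largest of the \<open>p(n)\<close> squares with sum \<open>n!\<close> is at least their average.\<close>
lemma large_num_standard:
  obtains la where "la \<in> partitions_of n"
    "sqrt (fact n) \<le> sqrt (real (card (partitions_of n))) * real_of_int (num_standard la)"
proof -
  let ?P = "partitions_of n"
  have "Max (num_standard ` ?P) \<in> num_standard ` ?P"
    using finite_partitions_of partitions_of_nonempty by (intro Max_in) auto
  then obtain la where la: "la \<in> ?P" "num_standard la = Max (num_standard ` ?P)" by auto
  have "(num_standard ka)\<^sup>2 \<le> (num_standard la)\<^sup>2" if "ka \<in> ?P" for ka
  proof (rule power_mono)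
    show "num_standard ka \<le> num_standard la"
      unfolding la(2) using that finite_partitions_of by (intro Max_ge) auto
    show "0 \<le> num_standard ka" using num_standard_pos[OF that] by simp
  qed
  then have "(\<Sum>ka\<in>?P. (num_standard ka)\<^sup>2) \<le> of_nat (card ?P) * (num_standard la)\<^sup>2"
    by (rule sum_bounded_above)
  then have "fact n \<le> int (card ?P) * (num_standard la)\<^sup>2" by (simp only: sum_num_standard_squares)
  then have "real_of_int (fact n) \<le> real_of_int (int (card ?P) * (num_standard la)\<^sup>2)"
    by (simp only: of_int_le_iff)
  then have "sqrt (fact n) \<le> sqrt (real (card ?P) * (real_of_int (num_standard la))\<^sup>2)" by simp
  also have "\<dots> = sqrt (real (card ?P)) * real_of_int (num_standard la)"
    using num_standard_pos[OF la(1)] by (simp add: real_sqrt_mult)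
  finally show ?thesis using la(1) that by blast
qed

text \<open>Choose \<open>\<lambda>\<close> with \<open>f\<^sup>\<lambda> \<ge> \<surd>(n!/p(n))\<close>. In the restriction identity there are \<open>p(k) p(n - k)\<close> terms, each
  at most the largest coefficient times \<open>\<surd>(k! (n - k)!)\<close>.\<close>
lemma LR_max_lower_bound:
  assumes "k \<le> n"
  shows "sqrt (real (n choose k)) \<le> real_of_int (LR_max n k) *
    (sqrt (real (card (partitions_of n))) * real (card (partitions_of k)) * real (card (partitions_of (n - k))))"
proof -
  define l where "l = n - k"
  have n: "n = k + l" using assms by (simp add: l_def)
  let ?f = "\<lambda>la. real_of_int (num_standard la)"
  let ?p = "\<lambda>n. real (card (partitions_of n))"
  let ?M = "real_of_int (LR_max n k)"
  obtain la where la: "la \<in> partitions_of n" "sqrt (fact n) \<le> sqrt (?p n) * ?f la"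
    using large_num_standard .
  obtain mu nu where ne: "mu \<in> partitions_of k" "nu \<in> partitions_of l"
    using partitions_of_nonempty by blast
  have "0 \<le> LR_max n k"
    using LR_coeff_nonneg[OF ne, of la] LR_coeff_le_max[of la n mu k nu] ne la(1) by (simp add: n)
  then have M: "0 \<le> ?M" by simp
  have "?f la = (\<Sum>mu\<in>partitions_of k. \<Sum>nu\<in>partitions_of l. real_of_int (LR_coeff la mu nu) * (?f mu * ?f nu))"
    using arg_cong[OF num_standard_restriction[of la k l], of real_of_int] la(1) by (simp add: n)
  also have "\<dots> \<le> (\<Sum>mu\<in>partitions_of k. \<Sum>nu\<in>partitions_of l. ?M * (sqrt (fact k) * sqrt (fact l)))"
  proof (intro sum_mono mult_mono num_standard_le_sqrt)
    fix mu nu assume *: "mu \<in> partitions_of k" "nu \<in> partitions_of l"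
    show "real_of_int (LR_coeff la mu nu) \<le> ?M"
      using LR_coeff_le_max[of la n mu k nu] * la(1) by (simp add: n)
    show "0 \<le> ?f nu" "0 \<le> ?f mu * ?f nu"
      using num_standard_pos[OF *(1)] num_standard_pos[OF *(2)] by simp_all
  qed (use M in auto)
  also have "\<dots> = ?M * (?p k * ?p l) * (sqrt (fact k) * sqrt (fact l))" by simp
  finally have "sqrt (fact n) \<le> sqrt (?p n) * (?M * (?p k * ?p l) * (sqrt (fact k) * sqrt (fact l)))"
    using la(2) by (meson mult_left_mono order_trans real_sqrt_ge_zero of_nat_0_le_iff)
  moreover have "real (n choose k) = fact n / (fact k * fact l)"
    using binomial_fact[of k n] assms by (simp add: l_def)
  then have "sqrt (real (n choose k)) = sqrt (fact n) / (sqrt (fact k) * sqrt (fact l))"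
    by (simp add: real_sqrt_divide real_sqrt_mult)
  moreover have "0 < sqrt (fact k) * sqrt (fact l :: real)" by simp
  ultimately have "sqrt (real (n choose k)) \<le> sqrt (?p n) * (?M * (?p k * ?p l))"
    by (simp add: divide_le_eq mult_ac)
  then show ?thesis by (simp add: l_def mult_ac)
qed

theorem theorem1p5:
  shows "\<exists>d::real. d > 0 \<and> (\<forall>n k :: nat. n > k \<and> k \<ge> 1 \<longrightarrow>
           sqrt (real (n choose k)) * exp (- d * sqrt (real n)) \<le> real_of_int (LR_max n k) \<and>
           real_of_int (LR_max n k) \<le> sqrt (real (n choose k)))"
proof (intro exI[of _ 35] conjI allI impI)
  fix n k :: nat assume "n > k \<and> k \<ge> 1"
  then have k: "1 \<le> k" "1 \<le> n - k" "k \<le> n" by auto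
  let ?p = "\<lambda>n. real (card (partitions_of n))"
  let ?M = "real_of_int (LR_max n k)"
  let ?r = "sqrt (real n)"
  obtain la mu nu where *: "la \<in> partitions_of n" "mu \<in> partitions_of k" "nu \<in> partitions_of (n - k)"
    "LR_max n k = LR_coeff la mu nu" by (rule LR_max_attained)
  have n: "k + (n - k) = n" using k by simp
  have la: "la \<in> partitions_of (k + (n - k))" using *(1) n by simp
  have sq: "(LR_max n k)\<^sup>2 \<le> int (n choose k)"
    using LR_coeff_square_le[OF la *(2,3)] n by (simp add: *(4))
  then have "real_of_int ((LR_max n k)\<^sup>2) \<le> real_of_int (int (n choose k))"
    by (simp only: of_int_le_iff)
  then show "?M \<le> sqrt (real (n choose k))" by (intro real_le_rsqrt) simp
  have M: "0 \<le> ?M" using LR_coeff_nonneg[OF *(2,3) la] by (simp add: *(4))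
  have p: "?p m \<le> exp (14 * ?r)" if "1 \<le> m" "m \<le> n" for m
  proof -
    have "?p m \<le> exp (14 * sqrt (real m))" by (rule card_partitions_le_exp_sqrt[OF that(1)])
    also have "\<dots> \<le> exp (14 * ?r)" using that by simp
    finally show ?thesis .
  qed
  have "sqrt (?p n) \<le> sqrt (exp (14 * ?r))" using p[of n] k by (intro real_sqrt_le_mono) simp
  also have "\<dots> = exp (7 * ?r)"
    by (rule real_sqrt_unique) (simp_all flip: exp_add add: power2_eq_square)
  finally have "sqrt (?p n) \<le> exp (7 * ?r)" .
  then have "sqrt (?p n) * ?p k * ?p (n - k) \<le> exp (7 * ?r) * exp (14 * ?r) * exp (14 * ?r)"
    using p[of k] p[of "n - k"] k by (intro mult_mono) auto
  also have "\<dots> = exp (35 * ?r)" by (simp flip: exp_add)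
  finally have "?M * (sqrt (?p n) * ?p k * ?p (n - k)) \<le> ?M * exp (35 * ?r)"
    using M by (rule mult_left_mono)
  with LR_max_lower_bound[OF k(3)] have "sqrt (real (n choose k)) \<le> ?M * exp (35 * ?r)"
    by (rule order_trans)
  then have "sqrt (real (n choose k)) * exp (- 35 * ?r) \<le> ?M * exp (35 * ?r) * exp (- 35 * ?r)"
    by (rule mult_right_mono) simp
  also have "\<dots> = ?M" by (simp add: mult.assoc flip: exp_add)
  finally show "sqrt (real (n choose k)) * exp (- 35 * ?r) \<le> ?M" .
qed simp

end
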